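(* Let $(\mathcal A,\mathcal C,E,\alpha^* )$ be a covariant positive flow with phase space $X$ and spectral potential $\lambda$, and let $(\mathcal B,C(\overline X),E,\sigma^* )$ be the suspension over it (over the positive process $(\mathcal A,\mathcal C,E)$), with spectral potential $\Lambda$. Let $i_\alpha:X\to\overline X=X^{\mathbb N}$, $i_\alpha(x)=(x,\alpha(x),\alpha^2(x),\dots)$. Then $i_\alpha$ establishes a one-to-one correspondence between the support of the initial positive flow and the support of the suspension over it. In addition, $\Lambda(\varphi)=\lambda(\varphi\circ i_\alpha)$ for all $\varphi\in C(\overline X)$.
   Context: All algebras are real and associative. A cone in a real vector space is a convex subset $K$ with $tK\subset K$ for $t\ge0$ and such that $v,-v\in K$ imply $v=0$; $u\le v$ means $v-u\in K$. A positive algebra is a real normed algebra $\mathcal A$ ($\|ab\|\le\|a\|\|b\|$) with unit $I$, $\|I\|=1$, and a cone $\mathcal A_+$ closed under products and containing $I$, whose norm is monotone: $\|u\|\le\|u+v\|$ for $u,v\in\mathcal A_+$. A phase subalgebra $\mathcal C\subset\mathcal A$ is a commutative subalgebra containing $I$ such that each $a\in\mathcal C$ satisfies $-tI\le a\le tI$ for some $t>0$. If $\mathcal A_+$ is closed, there is a Hausdorff compact set $X$, unique up to homeomorphism (the phase space), such that $\mathcal C$ is isomorphic, including the order, to a dense subalgebra of $C(X)$ (real continuous functions, supremum norm); $\mathcal C$ is identified with this subalgebra. When $\mathcal A$ is moreover complete, the inclusion $\mathcal C\to\mathcal A$ extends uniquely to a continuous, injective, positive homomorphism $C(X)\to\mathcal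 A$, by which $C(X)$ is regarded as a subalgebra of $\mathcal A$. A positive process $(\mathcal A,\mathcal C,E)$ consists of a positive algebra $\mathcal A$, complete in norm, with closed cone $\mathcal A_+$; a phase subalgebra $\mathcal C$ with phase space $X$; and $E\in\mathcal A_+$. A covariant positive flow $(\mathcal A,\mathcal C,E,\alpha^* )$ is a positive process together with a positive unital homomorphism $\alpha^*:\mathcal C\to\mathcal C$ with $Ef=\alpha^*(f)E$ for all $f\in\mathcal C$; there is a unique continuous $\alpha:X\to X$ with $\alpha^*(f)=f\circ\alpha$. The spectral potential is $\lambda(\varphi)=\lim_{n\to\infty}\frac1n\ln\|(e^\varphi E)^n\|$, $\varphi\in C(X)$; standing assumption: it is finite. A function $f\in C(X)$ is unessential for the flow if $fE^n=0$ for some $n\in\mathbb N$; the unessential functions form an ideal $\mathcal I\subset C(X)$ and the support of the flow is $\bigcap_{f\in\mathcal I}f^{-1}(0)\subset X$. Suspension over a positive process $(\mathcal A,\mathcal C,E)$: let $\overline X=X^{\mathbb N}$ be the set of sequences $(x_1,x_2,\dots)$ with the product topology, $\sigma(x_1,x_2,\dots)=(x_2,x_3,\dots)$, and let $C(X^n)\subset C(\overline X)$ be the functions depending only on the first $n$ coordinates ($C(X^0)=\mathbb R$). The crossed algebra $\mathcal B^0=C(\overline X)\times_\sigma\{E^n\}$ consists of formal sums $\sum_{i=0}^nF_iE^i$, $F_i\in C(\overline X)$, with multiplication $(FE^i)(GE^j)=(F\cdot(G\circ\sigma^i))E^{i+j}$ extended bilinearly; $\mathcal B_+$ is the cone of sums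 with all $F_i\ge0$; $\mathcal B_p$ is the subalgebra of proper operators, i.e. sums with $F_i\in C(X^i)$ for all $i\ge 0$. There is a unique positive unital homomorphism $\pi:\mathcal B_p\to\mathcal A$ (mapping $\mathcal B_p\cap\mathcal B_+$ into $\mathcal A_+$) with $\pi(f_1(x_1)\cdots f_n(x_n)E^n)=f_1Ef_2E\cdots f_nE$ for $f_i\in C(X)$. For $A\in\mathcal B_+$ put $\|A\|=\inf\{\|\pi(A')\| : A'\in\mathcal B_p,\ A'-A\in\mathcal B_+\}$ and for other $A\in\mathcal B^0$ put $\|A\|=\inf\{\|A'\|+\|A''\| : A',A''\in\mathcal B_+,\ A'-A''=A\}$. This is a submultiplicative seminorm; $\mathcal B$ is the completion of the quotient of $\mathcal B^0$ by the elements of zero seminorm, ordered by the closure of (the image of) $\mathcal B_+$. It is a positive Banach algebra containing $C(\overline X)$ (degree-zero operators) as a phase subalgebra, and with $\sigma^*(F)=F\circ\sigma$ the quadruple $(\mathcal B,C(\overline X),E,\sigma^* )$ (where $E$ is the crossed operator $1E$) is a covariant positive flow with phase space $\overline X$, called the suspension. *)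

theory Defs
  imports "HOL-Analysis.Analysis"
begin

section \<open>Positive algebras, phase subalgebras and flows\<close>

locale positive_algebra =
  fixes P :: "'a::real_normed_algebra_1 set"
  assumes convex_P: "convex P"
    and cone_P: "cone P"
    and pointed_P: "\<And>v. v \<in> P \<Longrightarrow> - v \<in> P \<Longrightarrow> v = 0"
    and mult_P: "\<And>u v. u \<in> P \<Longrightarrow> v \<in> P \<Longrightarrow> u * v \<in> P"
    and one_P: "1 \<in> P"
    and norm_mono_P: "\<And>u v. u \<in> P \<Longrightarrow> v \<in> P \<Longrightarrow> norm u \<le> norm (u + v)"

definition phase_subalgebra :: "'a::real_normed_algebra_1 set \<Rightarrow> 'a set \<Rightarrow> bool" where
  "phase_subalgebra P C \<longleftrightarrow>
     subspace C \<and> 1 \<in> C \<and>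
     (\<forall>a\<in>C. \<forall>b\<in>C. a * b \<in> C \<and> a * b = b * a) \<and>
     (\<forall>a\<in>C. \<exists>t>0. a + t *\<^sub>R 1 \<in> P \<and> t *\<^sub>R 1 - a \<in> P)"

text \<open>
  The phase space \<open>X\<close> is the whole type \<open>'x\<close>. The map \<open>\<theta>\<close> identifies \<open>C\<close> with a dense
  subalgebra of \<open>C(X)\<close>; elements of \<open>C(X)\<close> are functions \<open>f\<close> with \<^term>\<open>continuous_on UNIV f\<close>.
  The values of \<open>\<theta>\<close> outside \<open>C\<close> are irrelevant.
\<close>

definition phase_space ::
    "'a::real_normed_algebra_1 set \<Rightarrow> 'a set \<Rightarrow> ('a \<Rightarrow> 'x::t2_space \<Rightarrow> real) \<Rightarrow> bool" where
  "phase_space P C \<theta> \<longleftrightarrow>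
     compact (UNIV :: 'x set) \<and>
     (\<forall>a\<in>C. continuous_on UNIV (\<theta> a)) \<and>
     (\<forall>a\<in>C. \<forall>b\<in>C. \<theta> (a + b) = (\<lambda>x. \<theta> a x + \<theta> b x)) \<and>
     (\<forall>t. \<forall>a\<in>C. \<theta> (t *\<^sub>R a) = (\<lambda>x. t * \<theta> a x)) \<and>
     (\<forall>a\<in>C. \<forall>b\<in>C. \<theta> (a * b) = (\<lambda>x. \<theta> a x * \<theta> b x)) \<and>
     \<theta> 1 = (\<lambda>x. 1) \<and>
     inj_on \<theta> C \<and>
     (\<forall>a\<in>C. a \<in> P \<longleftrightarrow> (\<forall>x. 0 \<le> \<theta> a x)) \<and>
     (\<forall>f. continuous_on UNIV f \<longrightarrow> (\<forall>\<epsilon>>0. \<exists>a\<in>C. \<forall>x. \<bar>f x - \<theta> a x\<bar> < \<epsilon>))"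

locale positive_process = positive_algebra P
  for P :: "'a::{real_normed_algebra_1,banach} set" +
  fixes C :: "'a set" and \<theta> :: "'a \<Rightarrow> 'x::t2_space \<Rightarrow> real" and E :: 'a
  assumes closed_P: "closed P"
    and phase_subalgebra: "phase_subalgebra P C"
    and phase_space: "phase_space P C \<theta>"
    and E_in_P: "E \<in> P"

text \<open>
  The inclusion \<open>C(X) \<rightarrow> A\<close>: the continuous extension of the inclusion of \<open>C\<close>, where \<open>C\<close> carries
  the supremum norm of \<open>C(X)\<close>.
\<close>

definition phase_ext ::
    "'a::{real_normed_algebra_1,banach} set \<Rightarrow> ('a \<Rightarrow> 'x \<Rightarrow> real) \<Rightarrow> ('x \<Rightarrow> real) \<Rightarrow> 'a" where
  "phase_ext C \<theta> f =
     (THE a. \<exists>s. (\<forall>n. s n \<in> C) \<and> uniform_limit UNIV (\<lambda>n. \<theta> (s n)) f sequentially \<and> s \<longlonglongrightarrow> a)"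

locale covariant_positive_flow = positive_process P C \<theta> E
  for P :: "'a::{real_normed_algebra_1,banach} set"
    and C :: "'a set" and \<theta> :: "'a \<Rightarrow> 'x::t2_space \<Rightarrow> real" and E :: 'a +
  fixes \<alpha>s :: "'a \<Rightarrow> 'a"
  assumes \<alpha>s_in: "\<And>f. f \<in> C \<Longrightarrow> \<alpha>s f \<in> C"
    and \<alpha>s_add: "\<And>f g. f \<in> C \<Longrightarrow> g \<in> C \<Longrightarrow> \<alpha>s (f + g) = \<alpha>s f + \<alpha>s g"
    and \<alpha>s_scale: "\<And>t f. f \<in> C \<Longrightarrow> \<alpha>s (t *\<^sub>R f) = t *\<^sub>R \<alpha>s f"
    and \<alpha>s_mult: "\<And>f g. f \<in> C \<Longrightarrow> g \<in> C \<Longrightarrow> \<alpha>s (f * g) = \<alpha>s f * \<alpha>s g"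
    and \<alpha>s_one: "\<alpha>s 1 = 1"
    and \<alpha>s_pos: "\<And>f. f \<in> C \<Longrightarrow> f \<in> P \<Longrightarrow> \<alpha>s f \<in> P"
    and covariant: "\<And>f. f \<in> C \<Longrightarrow> E * f = \<alpha>s f * E"

text \<open>The continuous map \<open>\<alpha> : X \<rightarrow> X\<close> dual to \<open>\<alpha>\<^sup>*\<close>.\<close>

definition flow_map ::
    "'a set \<Rightarrow> ('a \<Rightarrow> 'x::t2_space \<Rightarrow> real) \<Rightarrow> ('a \<Rightarrow> 'a) \<Rightarrow> 'x \<Rightarrow> 'x" where
  "flow_map C \<theta> \<alpha>s =
     (THE \<alpha>. continuous_on UNIV \<alpha> \<and> (\<forall>f\<in>C. \<theta> (\<alpha>s f) = \<theta> f \<circ> \<alpha>))"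

text \<open>Logarithm with \<open>ln 0 = -\<infinity>\<close>, so that the spectral potential is \<open>-\<infinity>\<close> in the nilpotent case.\<close>

definition ln_ext :: "real \<Rightarrow> ereal" where
  "ln_ext r = (if r = 0 then - \<infinity> else ereal (ln r))"

definition spectral_potential ::
    "'a::{real_normed_algebra_1,banach} set \<Rightarrow> ('a \<Rightarrow> 'x \<Rightarrow> real) \<Rightarrow> 'a \<Rightarrow> ('x \<Rightarrow> real) \<Rightarrow> ereal" where
  "spectral_potential C \<theta> E \<phi> =
     lim (\<lambda>n. ln_ext (norm ((phase_ext C \<theta> (\<lambda>x. exp (\<phi> x)) * E) ^ n)) / ereal (real n))"

definition unessential ::
    "'a::{real_normed_algebra_1,banach} set \<Rightarrow> ('a \<Rightarrow> 'x::topological_space \<Rightarrow> real) \<Rightarrow> 'a \<Rightarrow>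
     ('x \<Rightarrow> real) \<Rightarrow> bool" where
  "unessential C \<theta> E f \<longleftrightarrow> continuous_on UNIV f \<and> (\<exists>n. phase_ext C \<theta> f * E ^ n = 0)"

definition flow_support ::
    "'a::{real_normed_algebra_1,banach} set \<Rightarrow> ('a \<Rightarrow> 'x::topological_space \<Rightarrow> real) \<Rightarrow> 'a \<Rightarrow> 'x set" where
  "flow_support C \<theta> E = {x. \<forall>f. unessential C \<theta> E f \<longrightarrow> f x = 0}"

section \<open>The crossed algebra\<close>

text \<open>
  Points of \<open>X\<^sup>\<nat>\<close> are functions \<^typ>\<open>nat \<Rightarrow> 'x\<close> with the product topology; the coordinate
  \<open>x\<^sub>1\<close> is \<open>x 0\<close>.
\<close>

definition shift :: "(nat \<Rightarrow> 'x) \<Rightarrow> nat \<Rightarrow> 'x" where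
  "shift x = (\<lambda>k. x (Suc k))"

lemma shift_funpow: "(shift ^^ i) x = (\<lambda>k. x (k + i))"
  by (induction i) (auto simp: shift_def)

lemma continuous_on_shift_funpow:
  "continuous_on UNIV ((shift ^^ i) :: (nat \<Rightarrow> 'x::topological_space) \<Rightarrow> _)"
  unfolding shift_funpow by (intro continuous_on_coordinatewise_then_product) auto

text \<open>The formal sum \<open>\<Sum>i. F\<^sub>i E\<^sup>i\<close> is represented by its coefficient sequence \<open>F\<close>.\<close>

typedef (overloaded) 'x crossed =
  "{F :: nat \<Rightarrow> (nat \<Rightarrow> 'x::topological_space) \<Rightarrow> real.
      finite {i. F i \<noteq> (\<lambda>x. 0)} \<and> (\<forall>i. continuous_on UNIV (F i))}"
  morphisms coeff Crossed
  by (rule exI[of _ "\<lambda>i x. 0"]) auto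

lemma finite_coeff: "finite {i. coeff A i \<noteq> (\<lambda>x. 0)}"
  using coeff[of A] by auto

lemma continuous_coeff: "continuous_on UNIV (coeff A i)"
  using coeff[of A] by auto

lemma crossed_eqI: "(\<And>i x. coeff A i x = coeff B i x) \<Longrightarrow> A = B"
  by (metis coeff_inject ext)

lemma coeff_Crossed:
  assumes "finite {i. F i \<noteq> (\<lambda>x. 0)}" "\<And>i. continuous_on UNIV (F i)"
  shows "coeff (Crossed F) = F"
  using assms by (intro Crossed_inverse) auto

definition crossed_term ::
    "((nat \<Rightarrow> 'x::topological_space) \<Rightarrow> real) \<Rightarrow> nat \<Rightarrow> 'x crossed" where
  "crossed_term F n = Crossed (\<lambda>i x. if i = n then F x else 0)"

lemma coeff_crossed_term:
  assumes "continuous_on UNIV F"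
  shows "coeff (crossed_term F n) i x = (if i = n then F x else 0)"
proof -
  have "{i. (\<lambda>x. if i = n then F x else 0) \<noteq> (\<lambda>x. 0)} \<subseteq> {n}"
    by auto
  then have "finite {i. (\<lambda>x. if i = n then F x else 0) \<noteq> (\<lambda>x. 0)}"
    by (rule finite_subset) simp
  moreover have "continuous_on UNIV (\<lambda>x. if i = n then F x else 0)" for i
    using assms by (cases "i = n") auto
  ultimately show ?thesis
    unfolding crossed_term_def by (subst coeff_Crossed) auto
qed

instantiation crossed :: (topological_space) real_algebra_1
begin

definition zero_crossed :: "'a crossed" where
  "0 = Crossed (\<lambda>i x. 0)"

definition one_crossed :: "'a crossed" where
  "1 = crossed_term (\<lambda>x. 1) 0"

definition plus_crossed :: "'a crossed \<Rightarrow> 'a crossed \<Rightarrow> 'a crossed" where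
  "A + B = Crossed (\<lambda>i x. coeff A i x + coeff B i x)"

definition uminus_crossed :: "'a crossed \<Rightarrow> 'a crossed" where
  "- A = Crossed (\<lambda>i x. - coeff A i x)"

definition minus_crossed :: "'a crossed \<Rightarrow> 'a crossed \<Rightarrow> 'a crossed" where
  "A - B = Crossed (\<lambda>i x. coeff A i x - coeff B i x)"

definition scaleR_crossed :: "real \<Rightarrow> 'a crossed \<Rightarrow> 'a crossed" where
  "t *\<^sub>R A = Crossed (\<lambda>i x. t * coeff A i x)"

text \<open>Bilinear extension of \<open>(F E\<^sup>i) (G E\<^sup>j) = (F \<cdot> (G \<circ> \<sigma>\<^sup>i)) E\<^sup>i\<^sup>+\<^sup>j\<close>.\<close>

definition times_crossed :: "'a crossed \<Rightarrow> 'a crossed \<Rightarrow> 'a crossed" where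
  "A * B = Crossed (\<lambda>k x. \<Sum>i\<le>k. coeff A i x * coeff B (k - i) ((shift ^^ i) x))"

lemma coeff_zero: "coeff (0 :: 'a crossed) i x = 0"
  unfolding zero_crossed_def by (subst coeff_Crossed) auto

lemma coeff_one: "coeff (1 :: 'a crossed) i x = (if i = 0 then 1 else 0)"
  unfolding one_crossed_def by (subst coeff_crossed_term) auto

lemma coeff_plus: "coeff (A + B :: 'a crossed) i x = coeff A i x + coeff B i x"
proof -
  have "{i. (\<lambda>x. coeff A i x + coeff B i x) \<noteq> (\<lambda>x. 0)} \<subseteq>
        {i. coeff A i \<noteq> (\<lambda>x. 0)} \<union> {i. coeff B i \<noteq> (\<lambda>x. 0)}" by auto
  then have "finite {i. (\<lambda>x. coeff A i x + coeff B i x) \<noteq> (\<lambda>x. 0)}"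
    by (rule finite_subset) (simp add: finite_coeff)
  then show ?thesis
    unfolding plus_crossed_def
    by (subst coeff_Crossed) (auto intro!: continuous_intros continuous_coeff)
qed

lemma coeff_scaleR: "coeff (t *\<^sub>R A :: 'a crossed) i x = t * coeff A i x"
proof -
  have "{i. (\<lambda>x. t * coeff A i x) \<noteq> (\<lambda>x. 0)} \<subseteq> {i. coeff A i \<noteq> (\<lambda>x. 0)}" by auto
  then have "finite {i. (\<lambda>x. t * coeff A i x) \<noteq> (\<lambda>x. 0)}"
    by (rule finite_subset) (simp add: finite_coeff)
  then show ?thesis
    unfolding scaleR_crossed_def
    by (subst coeff_Crossed) (auto intro!: continuous_intros continuous_coeff)
qed

lemma coeff_uminus: "coeff (- A :: 'a crossed) i x = - coeff A i x"
proof -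
  have "- A = (-1) *\<^sub>R A"
    unfolding uminus_crossed_def scaleR_crossed_def by simp
  then show ?thesis by (simp add: coeff_scaleR)
qed

lemma coeff_minus: "coeff (A - B :: 'a crossed) i x = coeff A i x - coeff B i x"
proof -
  have "A - B = A + (- B)"
    unfolding minus_crossed_def plus_crossed_def by (simp add: coeff_uminus)
  then show ?thesis by (simp add: coeff_plus coeff_uminus)
qed

lemma coeff_times:
  "coeff (A * B :: 'a crossed) k x = (\<Sum>i\<le>k. coeff A i x * coeff B (k - i) ((shift ^^ i) x))"
proof -
  let ?S = "{i. coeff A i \<noteq> (\<lambda>x. 0)}" and ?T = "{i. coeff B i \<noteq> (\<lambda>x. 0)}"
  let ?M = "\<lambda>k x. \<Sum>i\<le>k. coeff A i x * coeff B (k - i) ((shift ^^ i) x)"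
  have "{k. ?M k \<noteq> (\<lambda>x. 0)} \<subseteq> (\<lambda>(i, j). i + j) ` (?S \<times> ?T)"
  proof
    fix k assume "k \<in> {k. ?M k \<noteq> (\<lambda>x. 0)}"
    then obtain x where "?M k x \<noteq> 0" by auto
    then obtain i where i: "i \<le> k" "coeff A i x * coeff B (k - i) ((shift ^^ i) x) \<noteq> 0"
      by (meson atMost_iff sum.not_neutral_contains_not_neutral)
    then have "i \<in> ?S" "k - i \<in> ?T" by auto
    then show "k \<in> (\<lambda>(i, j). i + j) ` (?S \<times> ?T)"
      using i(1) by (intro image_eqI[of _ _ "(i, k - i)"]) auto
  qed
  then have "finite {k. ?M k \<noteq> (\<lambda>x. 0)}"
    by (rule finite_subset) (simp add: finite_coeff)
  moreover have "continuous_on UNIV (?M k)" for k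
    by (intro continuous_intros continuous_coeff
        continuous_on_compose2[OF continuous_coeff continuous_on_shift_funpow]) auto
  ultimately show ?thesis
    unfolding times_crossed_def by (subst coeff_Crossed) auto
qed

instance
proof
  fix A B D :: "'a crossed" and s t :: real
  show "A + B + D = A + (B + D)" "A + B = B + A" "0 + A = A" "- A + A = 0" "A - B = A + - B"
    by (rule crossed_eqI; simp add: coeff_plus coeff_zero coeff_uminus coeff_minus)+
  show "s *\<^sub>R (A + B) = s *\<^sub>R A + s *\<^sub>R B" "(s + t) *\<^sub>R A = s *\<^sub>R A + t *\<^sub>R A"
       "s *\<^sub>R t *\<^sub>R A = (s * t) *\<^sub>R A" "1 *\<^sub>R A = A"
    by (rule crossed_eqI; simp add: coeff_plus coeff_scaleR algebra_simps)+
  show "(A + B) * D = A * D + B * D" "A * (B + D) = A * B + A * D"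
       "s *\<^sub>R A * B = s *\<^sub>R (A * B)" "A * s *\<^sub>R B = s *\<^sub>R (A * B)"
    by (rule crossed_eqI;
        simp add: coeff_plus coeff_scaleR coeff_times algebra_simps sum.distrib sum_distrib_left)+
  show "1 * A = A"
  proof (rule crossed_eqI)
    fix k x
    have "coeff (1 * A) k x = (\<Sum>i\<le>k. if i = 0 then coeff A k x else 0)"
      unfolding coeff_times coeff_one by (intro sum.cong) auto
    then show "coeff (1 * A) k x = coeff A k x" by simp
  qed
  show "A * 1 = A"
  proof (rule crossed_eqI)
    fix k x
    have "coeff (A * 1) k x = (\<Sum>i\<le>k. if i = k then coeff A k x else 0)"
      unfolding coeff_times coeff_one by (intro sum.cong) auto
    then show "coeff (A * 1) k x = coeff A k x" by simp
  qed
  show "(0 :: 'a crossed) \<noteq> 1"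
  proof
    assume "(0 :: 'a crossed) = 1"
    then have "coeff (0 :: 'a crossed) 0 undefined = coeff 1 0 undefined" by simp
    then show False by (simp add: coeff_zero coeff_one)
  qed
  show "A * B * D = A * (B * D)"
  proof (rule crossed_eqI)
    fix k x
    let ?f = "\<lambda>i l m. coeff A i x * coeff B l ((shift ^^ i) x) * coeff D m ((shift ^^ (i + l)) x)"
    have "coeff (A * B * D) k x = (\<Sum>j=0..k. \<Sum>i=0..j. ?f i (j - i) (k - j))"
      unfolding coeff_times sum_distrib_right atLeast0AtMost by (intro sum.cong) auto
    also have "\<dots> = (\<Sum>j=0..k. \<Sum>i=0..k - j. ?f j i (k - j - i))"
      by (rule fps_mult_assoc_lemma)
    also have "\<dots> = coeff (A * (B * D)) k x"
      unfolding coeff_times sum_distrib_left atLeast0AtMost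
      by (intro sum.cong) (auto simp: shift_funpow algebra_simps)
    finally show "coeff (A * B * D) k x = coeff (A * (B * D)) k x" .
  qed
qed

end

definition crossed_pos :: "'x::topological_space crossed set" where
  "crossed_pos = {A. \<forall>i x. 0 \<le> coeff A i x}"

text \<open>A proper operator has its \<open>i\<close>-th coefficient in \<open>C(X\<^sup>i)\<close>.\<close>

definition depends_on_first :: "nat \<Rightarrow> ((nat \<Rightarrow> 'x) \<Rightarrow> real) \<Rightarrow> bool" where
  "depends_on_first n F \<longleftrightarrow> (\<forall>x y. (\<forall>k<n. x k = y k) \<longrightarrow> F x = F y)"

definition proper :: "'x::topological_space crossed set" where
  "proper = {A. \<forall>i. depends_on_first i (coeff A i)}"

section \<open>The suspension\<close>

definition is_susp_hom ::
    "'a::{real_normed_algebra_1,banach} set \<Rightarrow> 'a set \<Rightarrow> ('a \<Rightarrow> 'x::t2_space \<Rightarrow> real) \<Rightarrow> 'a \<Rightarrow>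
     ('x crossed \<Rightarrow> 'a) \<Rightarrow> bool" where
  "is_susp_hom P C \<theta> E \<pi> \<longleftrightarrow>
     (\<forall>A\<in>proper. \<forall>B\<in>proper. \<pi> (A + B) = \<pi> A + \<pi> B) \<and>
     (\<forall>t. \<forall>A\<in>proper. \<pi> (t *\<^sub>R A) = t *\<^sub>R \<pi> A) \<and>
     (\<forall>A\<in>proper. \<forall>B\<in>proper. \<pi> (A * B) = \<pi> A * \<pi> B) \<and>
     \<pi> 1 = 1 \<and>
     (\<forall>A\<in>proper \<inter> crossed_pos. \<pi> A \<in> P) \<and>
     (\<forall>n f. (\<forall>i<n. continuous_on UNIV (f i)) \<longrightarrow>
        \<pi> (crossed_term (\<lambda>x. \<Prod>i<n. f i (x i)) n) =
        prod_list (map (\<lambda>i. phase_ext C \<theta> (f i) * E) [0..<n]))"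

text \<open>
  The homomorphism \<open>\<pi>\<close>. It is determined only on \<^const>\<open>proper\<close>, hence \<open>SOME\<close> instead of \<open>THE\<close>;
  its values elsewhere are never used.
\<close>

definition susp_hom ::
    "'a::{real_normed_algebra_1,banach} set \<Rightarrow> 'a set \<Rightarrow> ('a \<Rightarrow> 'x::t2_space \<Rightarrow> real) \<Rightarrow> 'a \<Rightarrow>
     'x crossed \<Rightarrow> 'a" where
  "susp_hom P C \<theta> E = (SOME \<pi>. is_susp_hom P C \<theta> E \<pi>)"

definition susp_norm_pos ::
    "'a::{real_normed_algebra_1,banach} set \<Rightarrow> 'a set \<Rightarrow> ('a \<Rightarrow> 'x::t2_space \<Rightarrow> real) \<Rightarrow> 'a \<Rightarrow>
     'x crossed \<Rightarrow> real" where
  "susp_norm_pos P C \<theta> E A =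
     Inf {norm (susp_hom P C \<theta> E A') | A'. A' \<in> proper \<and> A' - A \<in> crossed_pos}"

definition susp_seminorm ::
    "'a::{real_normed_algebra_1,banach} set \<Rightarrow> 'a set \<Rightarrow> ('a \<Rightarrow> 'x::t2_space \<Rightarrow> real) \<Rightarrow> 'a \<Rightarrow>
     'x crossed \<Rightarrow> real" where
  "susp_seminorm P C \<theta> E A =
     (if A \<in> crossed_pos then susp_norm_pos P C \<theta> E A
      else Inf {susp_norm_pos P C \<theta> E A' + susp_norm_pos P C \<theta> E A'' | A' A''.
                A' \<in> crossed_pos \<and> A'' \<in> crossed_pos \<and> A' - A'' = A})"

text \<open>
  The Banach algebra \<open>'b\<close>, with the canonical map \<open>q\<close>, is the completion of the quotient of the
  crossed algebra by the elements of zero seminorm. These conditions determine the pair up to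
  isometric isomorphism. Its order (the closure of \<^term>\<open>q ` crossed_pos\<close>) and the endomorphism
  \<open>F \<mapsto> F \<circ> \<sigma>\<close> enter neither the support nor the spectral potential.
\<close>

definition suspension_completion ::
    "'a::{real_normed_algebra_1,banach} set \<Rightarrow> 'a set \<Rightarrow> ('a \<Rightarrow> 'x::t2_space \<Rightarrow> real) \<Rightarrow> 'a \<Rightarrow>
     ('x crossed \<Rightarrow> 'b::{real_normed_algebra_1,banach}) \<Rightarrow> bool" where
  "suspension_completion P C \<theta> E q \<longleftrightarrow>
     linear q \<and> (\<forall>A B. q (A * B) = q A * q B) \<and> q 1 = 1 \<and>
     (\<forall>A. norm (q A) = susp_seminorm P C \<theta> E A) \<and>
     closure (range q) = UNIV"

text \<open>
  The phase subalgebra \<open>C(X\<^sup>\<nat>)\<close> of degree-zero operators in the suspension, its identification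
  with functions on the phase space \<open>X\<^sup>\<nat>\<close>, and the crossed operator \<open>1 E\<close>.
\<close>

definition susp_phase :: "('x::topological_space crossed \<Rightarrow> 'b) \<Rightarrow> 'b set" where
  "susp_phase q = {q (crossed_term F 0) | F. continuous_on UNIV F}"

definition susp_gelfand ::
    "('x::topological_space crossed \<Rightarrow> 'b) \<Rightarrow> 'b \<Rightarrow> (nat \<Rightarrow> 'x) \<Rightarrow> real" where
  "susp_gelfand q b = (THE F. continuous_on UNIV F \<and> q (crossed_term F 0) = b)"

definition susp_E :: "('x::topological_space crossed \<Rightarrow> 'b) \<Rightarrow> 'b" where
  "susp_E q = q (crossed_term (\<lambda>x. 1) 1)"

text \<open>The map \<open>i\<^sub>\<alpha>\<close>.\<close>

definition itinerary :: "('x \<Rightarrow> 'x) \<Rightarrow> 'x \<Rightarrow> nat \<Rightarrow> 'x" where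
  "itinerary \<alpha> x = (\<lambda>k. (\<alpha> ^^ k) x)"

end

theory Submission
  imports Defs
begin

text \<open>
  Over a covariant flow the products \<open>f\<^sub>1 E f\<^sub>2 E \<dots> f\<^sub>n E\<close> collapse to \<open>(f\<^sub>1 \<cdot> f\<^sub>2 \<circ> \<alpha> \<cdots>) E\<^sup>n\<close>,
  so \<open>F E\<^sup>n \<mapsto> (F \<circ> i\<^sub>\<alpha>) E\<^sup>n\<close> is a positive homomorphism on the whole crossed algebra, and on
  proper operators it is the only candidate for \<open>\<pi>\<close>, by Stone--Weierstrass and positivity. For
  \<open>F \<ge> 0\<close> this gives \<open>\<parallel>(F \<circ> i\<^sub>\<alpha>) E\<^sup>n\<parallel> \<le> \<parallel>F E\<^sup>n\<parallel>\<close>, with equality if \<open>F\<close> depends on \<open>n\<close> coordinates only.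
  The supports are then compared by testing with the squares of \<open>f(x\<^sub>1)\<close> and of
  \<open>f(x\<^sub>k) - f(\<alpha>\<^sup>k\<^sup>-\<^sup>1 x\<^sub>1)\<close>. For the potentials, \<open>\<phi>\<close> is approximated by a function of \<open>m\<close>
  coordinates, which makes the two norms agree up to a factor \<open>e\<^bsup>n\<epsilon> + c\<^esup>\<close>.
\<close>

section \<open>Continuous functions on compact Hausdorff spaces\<close>

lemma open_vimage_coordinate: "open W \<Longrightarrow> open ((\<lambda>z::'a \<Rightarrow> 'b::topological_space. z i) -` W)"
  by (rule open_vimage[OF _ continuous_on_product_coordinates])

text \<open>The Stone-Weierstrass locale \<open>function_ring_on\<close> lives on Hausdorff types.
  Function spaces inherit the separation axioms because preimages of open sets under a coordinate
  are open.\<close>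

instance "fun" :: (type, t0_space) t0_space
proof
  fix x y :: "'a \<Rightarrow> 'b"
  assume "x \<noteq> y"
  then obtain i where "x i \<noteq> y i" by auto
  from t0_space_class.t0_space[OF this] obtain U where "open U" "\<not> (x i \<in> U \<longleftrightarrow> y i \<in> U)"
    by blast
  then show "\<exists>U. open U \<and> \<not> (x \<in> U \<longleftrightarrow> y \<in> U)"
    by (intro exI[of _ "(\<lambda>z. z i) -` U"]) (auto intro: open_vimage_coordinate)
qed

instance "fun" :: (type, t1_space) t1_space
proof
  fix x y :: "'a \<Rightarrow> 'b"
  assume "x \<noteq> y"
  then obtain i where "x i \<noteq> y i" by auto
  from t1_space_class.t1_space[OF this] obtain U where "open U" "x i \<in> U" "y i \<notin> U"
    by blast
  then show "\<exists>U. open U \<and> x \<in> U \<and> y \<notin> U"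
    by (intro exI[of _ "(\<lambda>z. z i) -` U"]) (auto intro: open_vimage_coordinate)
qed

instance "fun" :: (type, t2_space) t2_space
proof
  fix x y :: "'a \<Rightarrow> 'b"
  assume "x \<noteq> y"
  then obtain i where "x i \<noteq> y i" by auto
  from hausdorff[OF this] obtain U V
    where "open U" "open V" "x i \<in> U" "y i \<in> V" "U \<inter> V = {}" by blast
  then show "\<exists>U V. open U \<and> open V \<and> x \<in> U \<and> y \<in> V \<and> U \<inter> V = {}"
    by (intro exI[of _ "(\<lambda>z. z i) -` U"] exI[of _ "(\<lambda>z. z i) -` V"])
      (auto intro: open_vimage_coordinate)
qed

lemma compact_UNIV_fun:
  assumes "compact (UNIV :: 'b::topological_space set)"
  shows "compact (UNIV :: ('a \<Rightarrow> 'b) set)"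
proof -
  have "compact_space (product_topology (\<lambda>i::'a. euclidean :: 'b topology) UNIV)"
    unfolding compact_space_product_topology using assms by (simp add: compact_space_def)
  then show ?thesis
    by (simp add: euclidean_product_topology compact_space_def)
qed

lemma compact_UNIV_bounded:
  fixes f :: "'x::topological_space \<Rightarrow> real"
  assumes "compact (UNIV :: 'x set)" "continuous_on UNIV f"
  obtains M where "\<And>x. \<bar>f x\<bar> \<le> M" "0 < M"
proof -
  have "bounded (range f)"
    by (intro compact_imp_bounded compact_continuous_image assms)
  then obtain M where "0 < M" "\<forall>y\<in>range f. norm y \<le> M"
    unfolding bounded_pos by auto
  then show ?thesis using that[of M] by simp
qed

lemma compact_UNIV_positive_lower_bound:
  fixes f :: "'x::topological_space \<Rightarrow> real"
  assumes "compact (UNIV :: 'x set)" "continuous_on UNIV f" "\<And>x. 0 < f x"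
  obtains d where "0 < d" "\<And>x. d \<le> f x"
proof -
  obtain x where "\<forall>y. f x \<le> f y"
    using continuous_attains_inf[OF assms(1) _ assms(2)] by auto
  then show ?thesis using that[of "f x"] assms(3) by auto
qed

text \<open>A compact Hausdorff space is normal, so Urysohn's lemma applies to the closed sets
  \<open>- U\<close> and \<open>{x}\<close>. These bumps separate points and detect open
  neighbourhoods below.\<close>

lemma urysohn_function:
  fixes x :: "'x::t2_space"
  assumes "compact (UNIV :: 'x set)" "open U" "x \<in> U"
  obtains f :: "'x \<Rightarrow> real" where "continuous_on UNIV f" "f x = 1" "\<And>y. y \<notin> U \<Longrightarrow> f y = 0"
proof -
  have "compact_space (euclidean :: 'x topology)"
    using assms by (simp add: compact_space_def)
  moreover have "Hausdorff_space (euclidean :: 'x topology)"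
    unfolding Hausdorff_space_def disjnt_def by (auto dest!: hausdorff)
  ultimately have "normal_space (euclidean :: 'x topology)"
    using compact_Hausdorff_or_regular_imp_normal_space by blast
  moreover have "closedin euclidean (- U)" "closedin euclidean {x}" "disjnt (- U) {x}"
    using assms by (auto simp: disjnt_def)
  ultimately obtain f where f: "continuous_map euclidean (top_of_set {0..1::real}) f"
      "f ` (- U) \<subseteq> {0}" "f ` {x} \<subseteq> {1}"
    by (rule Urysohn_lemma[where a = 0 and b = 1]) simp
  have "continuous_on UNIV f"
    using f(1) by (simp add: continuous_map_in_subtopology)
  moreover have "f x = 1" "\<And>y. y \<notin> U \<Longrightarrow> f y = 0"
    using f(2,3) by auto
  ultimately show ?thesis by (rule that)
qed

lemma urysohn_separates:
  fixes x y :: "'x::t2_space"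
  assumes "compact (UNIV :: 'x set)" "x \<noteq> y"
  obtains f :: "'x \<Rightarrow> real" where "continuous_on UNIV f" "f x \<noteq> f y"
proof -
  obtain U where "open U" "x \<in> U" "y \<notin> U"
    using t1_space_class.t1_space[OF assms(2)] by blast
  with urysohn_function[OF assms(1)] obtain f :: "'x \<Rightarrow> real"
    where "continuous_on UNIV f" "f x = 1" "f y = 0" by metis
  then show ?thesis using that[of f] by simp
qed

section \<open>Functions of finitely many coordinates on the sequence space\<close>

lemma continuous_on_coordinate:
  fixes f :: "'x::topological_space \<Rightarrow> real"
  assumes "continuous_on UNIV f"
  shows "continuous_on UNIV (\<lambda>y::nat \<Rightarrow> 'x. f (y k))"
  using continuous_on_compose2[OF assms continuous_on_product_coordinates] by simp

lemma depends_on_first_mono: "depends_on_first m F \<Longrightarrow> m \<le> n \<Longrightarrow> depends_on_first n F"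
  unfolding depends_on_first_def by (meson less_le_trans)

lemma depends_on_first_map2:
  assumes "depends_on_first n F" "depends_on_first n G"
  shows "depends_on_first n (\<lambda>x. h (F x) (G x))"
  using assms unfolding depends_on_first_def by (intro allI impI arg_cong2[of _ _ _ _ h]) auto

text \<open>Stone-Weierstrass: functions of finitely many coordinates form an algebra, and a
  coordinate where two sequences differ separates them. The potential \<open>\<phi>\<close> of the
  suspension is later approximated in this way.\<close>

lemma cylinder_dense:
  fixes F :: "(nat \<Rightarrow> 'x::t2_space) \<Rightarrow> real"
  assumes X: "compact (UNIV :: 'x set)" and F: "continuous_on UNIV F" and "0 < \<epsilon>"
  obtains G m where "continuous_on UNIV G" "depends_on_first m G" "\<And>x. \<bar>F x - G x\<bar> < \<epsilon>"
proof -
  let ?R = "{G :: (nat \<Rightarrow> 'x) \<Rightarrow> real. continuous_on UNIV G \<and> (\<exists>m. depends_on_first m G)}"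
  \<comment> \<open>Functions of \<open>m\<close> and of \<open>n\<close> coordinates are both
    functions of \<open>max m n\<close> coordinates; the generic \<open>h\<close> covers sum and
    product at once.\<close>
  have closed: "(\<lambda>x. h (G x) (H x)) \<in> ?R"
    if GH: "G \<in> ?R" "H \<in> ?R" and h: "\<And>a b. continuous_on UNIV a \<Longrightarrow> continuous_on UNIV b \<Longrightarrow>
        continuous_on UNIV (\<lambda>x::nat \<Rightarrow> 'x. h (a x) (b x))" for h :: "real \<Rightarrow> real \<Rightarrow> real" and G H
  proof -
    from GH obtain m n where "depends_on_first m G" "depends_on_first n H" by auto
    then have "depends_on_first (max m n) G" "depends_on_first (max m n) H"
      by (auto elim: depends_on_first_mono)
    from depends_on_first_map2[OF this, of h] show ?thesis using GH h by auto
  qed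
  interpret function_ring_on ?R UNIV
  proof
    show "compact (UNIV :: (nat \<Rightarrow> 'x) set)" by (rule compact_UNIV_fun[OF X])
    fix G H assume GH: "G \<in> ?R" "H \<in> ?R"
    show "(\<lambda>x. G x + H x) \<in> ?R" "(\<lambda>x. G x * H x) \<in> ?R"
      by (rule closed[OF GH, of "(+)"] closed[OF GH, of "(*)"]; intro continuous_intros; assumption)+
  next
    fix x y :: "nat \<Rightarrow> 'x" assume "x \<noteq> y"
    then obtain k where "x k \<noteq> y k" by auto
    then obtain f :: "'x \<Rightarrow> real" where f: "continuous_on UNIV f" "f (x k) \<noteq> f (y k)"
      using urysohn_separates[OF X] by metis
    have "continuous_on UNIV (\<lambda>z::nat \<Rightarrow> 'x. f (z k))"
      by (rule continuous_on_coordinate[OF f(1)])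
    moreover have "depends_on_first (Suc k) (\<lambda>z. f (z k))"
      by (auto simp: depends_on_first_def)
    ultimately show "\<exists>G\<in>?R. G x \<noteq> G y"
      using f(2) by (intro bexI[of _ "\<lambda>z. f (z k)"]) auto
  qed (auto simp: depends_on_first_def)
  show ?thesis
    using Stone_Weierstrass_basic[OF F \<open>0 < \<epsilon>\<close>] that by auto
qed

text \<open>The algebraic tensor power of \<open>C(X)\<close>: the span of the monomials on which
  \<open>is_susp_hom\<close> prescribes the homomorphism. Induction along it transfers agreement
  from monomials to their sums.\<close>

inductive product_span :: "nat \<Rightarrow> ((nat \<Rightarrow> 'x::topological_space) \<Rightarrow> real) \<Rightarrow> bool" for n where
  product: "(\<And>i. i < n \<Longrightarrow> continuous_on UNIV (f i)) \<Longrightarrow>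
    product_span n (\<lambda>x. c * (\<Prod>i<n. f i (x i)))"
| sum: "product_span n F \<Longrightarrow> product_span n G \<Longrightarrow> product_span n (\<lambda>x. F x + G x)"

lemma continuous_on_product_fun:
  fixes f :: "nat \<Rightarrow> 'x::topological_space \<Rightarrow> real"
  assumes "\<And>i. i < n \<Longrightarrow> continuous_on UNIV (f i)"
  shows "continuous_on UNIV (\<lambda>x. \<Prod>i<n. f i (x i))"
proof (intro continuous_on_prod)
  fix i assume "i \<in> {..<n}"
  then show "continuous_on UNIV (\<lambda>x. f i (x i))"
    using continuous_on_compose2[OF assms continuous_on_product_coordinates] by simp
qed

lemma product_span_continuous: "product_span n F \<Longrightarrow> continuous_on UNIV F"
proof (induction rule: product_span.induct)
  case (product f c)
  then show ?case by (intro continuous_on_mult_left continuous_on_product_fun)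
next
  case (sum F G)
  then show ?case by (intro continuous_on_add)
qed

lemma product_span_depends: "product_span n F \<Longrightarrow> depends_on_first n F"
proof (induction rule: product_span.induct)
  case (product f c)
  show ?case unfolding depends_on_first_def by (auto intro!: prod.cong)
next
  case (sum F G)
  from depends_on_first_map2[OF sum(3,4), of "(+)"] show ?case .
qed

lemma product_span_mult:
  "product_span n F \<Longrightarrow> product_span n G \<Longrightarrow> product_span n (\<lambda>x. F x * G x)"
proof (induction arbitrary: G rule: product_span.induct)
  case (product f c)
  from product(2) show ?case
  proof (induction rule: product_span.induct)
    case (product g d)
    have "product_span n (\<lambda>x. (c * d) * (\<Prod>i<n. f i (x i) * g i (x i)))"
      by (rule product_span.product[of n "\<lambda>i x. f i x * g i x"])
        (intro continuous_on_mult product \<open>\<And>i. i < n \<Longrightarrow> continuous_on UNIV (f i)\<close>)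
    then show ?case by (simp add: prod.distrib algebra_simps)
  next
    case (sum F G)
    from product_span.sum[OF sum(3,4)] show ?case by (simp add: algebra_simps)
  qed
next
  case (sum F H)
  from product_span.sum[OF sum(3,4)[OF sum(5)]] show ?case by (simp add: algebra_simps)
qed

lemma product_span_const: "product_span n (\<lambda>x. c)"
  using product_span.product[of n "\<lambda>i x. 1" c] by simp

text \<open>Products over the first \<open>n\<close> coordinates do not separate sequences that
  differ only later. Freezing the tail gives a compact slice \<open>S\<close> on which they do, so
  Stone-Weierstrass applies there.\<close>

lemma product_span_dense:
  fixes F :: "(nat \<Rightarrow> 'x::t2_space) \<Rightarrow> real"
  assumes X: "compact (UNIV :: 'x set)"
    and F: "continuous_on UNIV F" "depends_on_first n F" and "0 < \<epsilon>"
  obtains G where "product_span n G" "\<And>x. \<bar>F x - G x\<bar> < \<epsilon>"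
proof -
  \<comment> \<open>Any point may fill the tail; types are nonempty, so \<open>undefined\<close>
    will do.\<close>
  define x0 :: 'x where "x0 = undefined"
  define S where "S = {z :: nat \<Rightarrow> 'x. \<forall>k\<ge>n. z k = x0}"
  have "S = (\<Inter>k\<in>{n..}. (\<lambda>z. z k) -` {x0})"
    by (auto simp: S_def)
  moreover have "closed \<dots>"
    by (intro closed_INT ballI closed_vimage closed_singleton continuous_on_product_coordinates)
  ultimately have "compact S"
    using compact_Int_closed[OF compact_UNIV_fun[OF X], of S] by simp
  interpret function_ring_on "Collect (product_span n)" S
  proof
    fix x y assume xy: "x \<in> S" "y \<in> S" "x \<noteq> y"
    then obtain k where k: "x k \<noteq> y k" by auto
    have "k < n"
    proof (rule ccontr)
      assume "\<not> k < n"
      with xy(1,2) have "x k = x0" "y k = x0" by (auto simp: S_def)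
      with k show False by simp
    qed
    from k obtain f :: "'x \<Rightarrow> real" where f: "continuous_on UNIV f" "f (x k) \<noteq> f (y k)"
      using urysohn_separates[OF X] by metis
    have "product_span n (\<lambda>z. 1 * (\<Prod>i<n. (if i = k then f else (\<lambda>_. 1)) (z i)))"
      using f by (intro product_span.product) auto
    moreover have "(\<Prod>i<n. (if i = k then f else (\<lambda>_. 1)) (z i)) = f (z k)" for z
    proof -
      have "(\<Prod>i<n. (if i = k then f else (\<lambda>_. 1)) (z i)) = (\<Prod>i<n. if i = k then f (z i) else 1)"
        by (intro prod.cong) auto
      then show ?thesis using \<open>k < n\<close> by simp
    qed
    ultimately have "product_span n (\<lambda>z. f (z k))" by simp
    with f show "\<exists>f\<in>Collect (product_span n). f x \<noteq> f y" by (intro bexI[of _ "\<lambda>z. f (z k)"]) auto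
  next
    fix f g :: "(nat \<Rightarrow> 'x) \<Rightarrow> real" assume "f \<in> Collect (product_span n)"
    then have f: "product_span n f" by simp
    show "continuous_on S f"
      using continuous_on_subset[OF product_span_continuous[OF f]] by simp
    assume "g \<in> Collect (product_span n)"
    then have g: "product_span n g" by simp
    show "(\<lambda>x. f x + g x) \<in> Collect (product_span n)"
      using product_span.sum[OF f g] by simp
    show "(\<lambda>x. f x * g x) \<in> Collect (product_span n)"
      using product_span_mult[OF f g] by simp
  qed (use \<open>compact S\<close> product_span_const in simp_all)
  obtain G where G: "product_span n G" "\<forall>x\<in>S. \<bar>F x - G x\<bar> < \<epsilon>"
    using Stone_Weierstrass_basic[OF continuous_on_subset[OF F(1)] \<open>0 < \<epsilon>\<close>] by auto
  have "\<bar>F x - G x\<bar> < \<epsilon>" for x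
  proof -
    \<comment> \<open>Refilling the tail of \<open>x\<close> leads into \<open>S\<close> and changes
      neither \<open>F\<close> nor \<open>G\<close>, as both read only the first \<open>n\<close>
      coordinates.\<close>
    let ?z = "\<lambda>k. if k < n then x k else x0"
    have "F x = F ?z" "G x = G ?z"
      using F(2) product_span_depends[OF G(1)] unfolding depends_on_first_def by auto
    then show ?thesis using G(2) by (simp add: S_def)
  qed
  with G(1) that show ?thesis by blast
qed

section \<open>The inclusion of the continuous functions\<close>

text \<open>What makes extension by uniform limits unambiguous: the algebra norm is controlled by
  the supremum norm. The locale is instantiated both for the initial phase subalgebra and for the
  degree-zero operators of the suspension.\<close>

locale bounded_inclusion =
  fixes C :: "'a::{real_normed_algebra_1,banach} set" and \<theta> :: "'a \<Rightarrow> 'x \<Rightarrow> real" and K :: real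
  assumes subspace_C: "subspace C"
    and theta_diff: "\<And>a b x. a \<in> C \<Longrightarrow> b \<in> C \<Longrightarrow> \<theta> (a - b) x = \<theta> a x - \<theta> b x"
    and norm_le_sup: "\<And>a t. a \<in> C \<Longrightarrow> (\<And>x. \<bar>\<theta> a x\<bar> \<le> t) \<Longrightarrow> norm a \<le> K * t"
    and K_pos: "0 < K"
begin

lemma uniform_limits_merge:
  assumes s: "\<And>n. s n \<in> C" "uniform_limit UNIV (\<lambda>n. \<theta> (s n)) f sequentially"
    and r: "\<And>n. r n \<in> C" "uniform_limit UNIV (\<lambda>n. \<theta> (r n)) f sequentially"
  shows "(\<lambda>n. s n - r n) \<longlonglongrightarrow> 0"
proof (rule LIMSEQ_I)
  fix e :: real assume "0 < e"
  \<comment> \<open>Approximants within \<open>d\<close> of \<open>f\<close> are within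
    \<open>2 * d\<close> of each other, hence at norm distance at most
    \<open>K * (2 * d) = e / 2\<close>.\<close>
  define d where "d = e / (4 * K)"
  have "0 < d" using \<open>0 < e\<close> K_pos by (simp add: d_def)
  have "\<forall>\<^sub>F n in sequentially. (\<forall>x. dist (\<theta> (s n) x) (f x) < d) \<and> (\<forall>x. dist (\<theta> (r n) x) (f x) < d)"
    using uniform_limitD[OF s(2) \<open>0 < d\<close>] uniform_limitD[OF r(2) \<open>0 < d\<close>]
    by eventually_elim simp
  then obtain N where N: "\<And>n x. n \<ge> N \<Longrightarrow> dist (\<theta> (s n) x) (f x) < d"
      "\<And>n x. n \<ge> N \<Longrightarrow> dist (\<theta> (r n) x) (f x) < d"
    unfolding eventually_sequentially by blast
  have "norm (s n - r n - 0) < e" if "n \<ge> N" for n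
  proof -
    have "\<bar>\<theta> (s n - r n) x\<bar> \<le> 2 * d" for x
      using N[OF that, of x] unfolding theta_diff[OF s(1) r(1)] dist_real_def by linarith
    then have "norm (s n - r n) \<le> K * (2 * d)"
      by (intro norm_le_sup subspace_diff[OF subspace_C] s r)
    also have "\<dots> < e" using \<open>0 < e\<close> K_pos by (simp add: d_def)
    finally show ?thesis by simp
  qed
  then show "\<exists>N. \<forall>n\<ge>N. norm (s n - r n - 0) < e" by blast
qed

text \<open>Any other sequence with the same uniform limit merges with \<open>s\<close>, so the
  limit is unique and the description in \<open>phase_ext\<close> denotes it.\<close>

lemma phase_ext_eq:
  assumes s: "\<And>n. s n \<in> C" "uniform_limit UNIV (\<lambda>n. \<theta> (s n)) f sequentially" "s \<longlonglongrightarrow> a"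
  shows "phase_ext C \<theta> f = a"
  unfolding phase_ext_def
proof (rule the_equality)
  show "\<exists>s. (\<forall>n. s n \<in> C) \<and> uniform_limit UNIV (\<lambda>n. \<theta> (s n)) f sequentially \<and> s \<longlonglongrightarrow> a"
    using s by blast
  fix b assume "\<exists>r. (\<forall>n. r n \<in> C) \<and> uniform_limit UNIV (\<lambda>n. \<theta> (r n)) f sequentially \<and> r \<longlonglongrightarrow> b"
  then obtain r where r: "\<And>n. r n \<in> C" "uniform_limit UNIV (\<lambda>n. \<theta> (r n)) f sequentially" "r \<longlonglongrightarrow> b"
    by blast
  from tendsto_diff[OF s(3) r(3)] uniform_limits_merge[OF s(1,2) r(1,2)] show "b = a"
    using LIMSEQ_unique by fastforce
qed

lemma phase_ext_theta: "a \<in> C \<Longrightarrow> phase_ext C \<theta> (\<theta> a) = a"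
  by (rule phase_ext_eq[of "\<lambda>_. a"]) (auto simp: uniform_limit_iff)

end

section \<open>Order and norm in a positive algebra\<close>

lemma (in positive_algebra) norm_mono: "u \<in> P \<Longrightarrow> v - u \<in> P \<Longrightarrow> norm u \<le> norm v"
  using norm_mono_P[of u "v - u"] by simp

lemma (in positive_algebra) add_P: "u \<in> P \<Longrightarrow> v \<in> P \<Longrightarrow> u + v \<in> P"
  using convex_cone[of P] convex_P cone_P by blast

lemma (in positive_algebra) scale_P: "u \<in> P \<Longrightarrow> 0 \<le> t \<Longrightarrow> t *\<^sub>R u \<in> P"
  using cone_P unfolding cone_def by blast

lemma (in positive_algebra) power_P: "u \<in> P \<Longrightarrow> u ^ n \<in> P"
  by (induction n) (auto intro: one_P mult_P)

context positive_process
begin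

lemma compact_X: "compact (UNIV :: 'x set)"
  using phase_space unfolding phase_space_def by blast

lemma subspace_C: "subspace C" and one_C: "1 \<in> C"
  and mult_C: "a \<in> C \<Longrightarrow> b \<in> C \<Longrightarrow> a * b \<in> C"
  using phase_subalgebra unfolding phase_subalgebra_def by blast+

lemma scale_one_C: "t *\<^sub>R 1 \<in> C"
  by (intro subspace_scale[OF subspace_C] one_C)

lemma
  shows continuous_theta: "a \<in> C \<Longrightarrow> continuous_on UNIV (\<theta> a)"
    and theta_add: "a \<in> C \<Longrightarrow> b \<in> C \<Longrightarrow> \<theta> (a + b) x = \<theta> a x + \<theta> b x"
    and theta_scale: "a \<in> C \<Longrightarrow> \<theta> (t *\<^sub>R a) x = t * \<theta> a x"
    and theta_mult: "a \<in> C \<Longrightarrow> b \<in> C \<Longrightarrow> \<theta> (a * b) x = \<theta> a x * \<theta> b x"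
    and theta_one: "\<theta> 1 x = 1"
    and theta_pos_iff: "a \<in> C \<Longrightarrow> a \<in> P \<longleftrightarrow> (\<forall>x. 0 \<le> \<theta> a x)"
    and theta_dense: "continuous_on UNIV f \<Longrightarrow> 0 < \<epsilon> \<Longrightarrow> \<exists>a\<in>C. \<forall>x. \<bar>f x - \<theta> a x\<bar> < \<epsilon>"
  using phase_space unfolding phase_space_def by simp_all

lemma theta_const: "\<theta> (t *\<^sub>R 1) x = t"
  by (simp add: theta_scale one_C theta_one)

lemma theta_diff: "a \<in> C \<Longrightarrow> b \<in> C \<Longrightarrow> \<theta> (a - b) x = \<theta> a x - \<theta> b x"
  using theta_add[of a "- b" x] theta_scale[of b "-1" x]
  by (simp add: subspace_neg[OF subspace_C])

text \<open>Norm monotonicity is assumed on the cone, so \<open>a\<close> is shifted: from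
  \<open>0 \<le> a + t \<le> 2 * t\<close> the norm of \<open>a + t\<close> is at most
  \<open>2 * t\<close>, and undoing the shift costs another \<open>t\<close>. Hence the constant
  3.\<close>

sublocale bounded_inclusion C \<theta> 3
proof
  fix a t assume a: "a \<in> C" "\<And>x. \<bar>\<theta> a x\<bar> \<le> t"
  have "0 \<le> t" using a(2)[of undefined] by linarith
  have t: "- t \<le> \<theta> a x" "\<theta> a x \<le> t" for x using a(2)[of x] by auto
  have "a + t *\<^sub>R 1 \<in> C" "t *\<^sub>R 1 - a \<in> C"
    by (intro subspace_add subspace_diff subspace_C scale_one_C a(1))+
  then have "a + t *\<^sub>R 1 \<in> P" "t *\<^sub>R 1 - a \<in> P"
    using t by (auto simp: theta_pos_iff theta_add theta_diff theta_const a(1) scale_one_C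
        neg_le_iff_le minus_le_iff add.commute le_diff_eq simp del: scaleR_scaleR)
      (smt (verit) t)
  from norm_mono_P[OF this] have "norm (a + t *\<^sub>R 1) \<le> 2 * t"
    using \<open>0 \<le> t\<close> by (simp flip: scaleR_add_left)
  then show "norm a \<le> 3 * t"
    using norm_triangle_ineq4[of "a + t *\<^sub>R 1" "t *\<^sub>R 1"] \<open>0 \<le> t\<close> by simp
qed (auto simp: subspace_C theta_diff)

abbreviation \<iota> :: "('x \<Rightarrow> real) \<Rightarrow> 'a" where "\<iota> \<equiv> phase_ext C \<theta>"

text \<open>Existence of the extension: density supplies uniform approximants, the bound
  \<open>norm_le_sup\<close> makes them Cauchy, and completeness supplies the limit.\<close>

lemma phase_ext_approx:
  assumes f: "continuous_on UNIV f"
  obtains s where "\<And>n. s n \<in> C" "uniform_limit UNIV (\<lambda>n. \<theta> (s n)) f sequentially" "s \<longlonglongrightarrow> \<iota> f"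
proof -
  have "\<forall>n. \<exists>a\<in>C. \<forall>x. \<bar>f x - \<theta> a x\<bar> < inverse (real (Suc n))"
    using theta_dense[OF f] by simp
  then obtain s where s: "\<And>n. s n \<in> C" "\<And>n x. \<bar>f x - \<theta> (s n) x\<bar> < inverse (real (Suc n))"
    by metis
  have lim: "uniform_limit UNIV (\<lambda>n. \<theta> (s n)) f sequentially"
    unfolding uniform_limit_iff
  proof (intro allI impI)
    fix e :: real assume "0 < e"
    then obtain N where N: "inverse (real (Suc N)) < e" using reals_Archimedean by blast
    have "dist (\<theta> (s n) x) (f x) < e" if "n \<ge> N" for n x
    proof -
      have "inverse (real (Suc n)) \<le> inverse (real (Suc N))" using that by simp
      with s(2)[of x n] N have "\<bar>f x - \<theta> (s n) x\<bar> < e" by linarith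
      then show ?thesis by (simp add: dist_real_def abs_minus_commute)
    qed
    then show "\<forall>\<^sub>F n in sequentially. \<forall>x\<in>UNIV. dist (\<theta> (s n) x) (f x) < e"
      unfolding eventually_sequentially by blast
  qed
  have "Cauchy s"
  proof (rule metric_CauchyI)
    fix e :: real assume "0 < e"
    then obtain N where N: "inverse (real (Suc N)) < e / 6"
      using reals_Archimedean[of "e / 6"] by auto
    have "dist (s m) (s n) < e" if "m \<ge> N" "n \<ge> N" for m n
    proof -
      have "inverse (real (Suc n)) \<le> inverse (real (Suc N))"
        "inverse (real (Suc m)) \<le> inverse (real (Suc N))" using that by simp_all
      then have "\<bar>\<theta> (s m - s n) x\<bar> \<le> 2 * inverse (real (Suc N))" for x
        unfolding theta_diff[OF s(1) s(1)] using s(2)[of x m] s(2)[of x n] by linarith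
      then have "norm (s m - s n) \<le> 3 * (2 * inverse (real (Suc N)))"
        by (intro norm_le_sup subspace_diff[OF subspace_C] s)
      then show ?thesis using N by (simp add: dist_norm)
    qed
    then show "\<exists>N. \<forall>m\<ge>N. \<forall>n\<ge>N. dist (s m) (s n) < e" by blast
  qed
  then obtain a where a: "s \<longlonglongrightarrow> a" using Cauchy_convergent convergent_def by blast
  show ?thesis
    using that[OF s(1) lim] a phase_ext_eq[OF s(1) lim a] by simp
qed

lemma phase_ext_add:
  assumes "continuous_on UNIV f" "continuous_on UNIV g"
  shows "\<iota> (\<lambda>x. f x + g x) = \<iota> f + \<iota> g"
proof -
  obtain s where s: "\<And>n. s n \<in> C" "uniform_limit UNIV (\<lambda>n. \<theta> (s n)) f sequentially" "s \<longlonglongrightarrow> \<iota> f"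
    using phase_ext_approx[OF assms(1)] by blast
  obtain r where r: "\<And>n. r n \<in> C" "uniform_limit UNIV (\<lambda>n. \<theta> (r n)) g sequentially" "r \<longlonglongrightarrow> \<iota> g"
    using phase_ext_approx[OF assms(2)] by blast
  show ?thesis
  proof (rule phase_ext_eq[of "\<lambda>n. s n + r n"])
    show "s n + r n \<in> C" for n by (intro subspace_add subspace_C s r)
    have "\<theta> (s n + r n) = (\<lambda>x. \<theta> (s n) x + \<theta> (r n) x)" for n
      using theta_add s r by blast
    then show "uniform_limit UNIV (\<lambda>n. \<theta> (s n + r n)) (\<lambda>x. f x + g x) sequentially"
      using uniform_limit_add[OF s(2) r(2)] by simp
    show "(\<lambda>n. s n + r n) \<longlonglongrightarrow> \<iota> f + \<iota> g" by (intro tendsto_add s r)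
  qed
qed

lemma phase_ext_mult:
  assumes "continuous_on UNIV f" "continuous_on UNIV g"
  shows "\<iota> (\<lambda>x. f x * g x) = \<iota> f * \<iota> g"
proof -
  obtain s where s: "\<And>n. s n \<in> C" "uniform_limit UNIV (\<lambda>n. \<theta> (s n)) f sequentially" "s \<longlonglongrightarrow> \<iota> f"
    using phase_ext_approx[OF assms(1)] by blast
  obtain r where r: "\<And>n. r n \<in> C" "uniform_limit UNIV (\<lambda>n. \<theta> (r n)) g sequentially" "r \<longlonglongrightarrow> \<iota> g"
    using phase_ext_approx[OF assms(2)] by blast
  have bounded: "bounded (range h)" if "continuous_on UNIV h" for h :: "'x \<Rightarrow> real"
    by (intro compact_imp_bounded compact_continuous_image that compact_X)
  show ?thesis
  proof (rule phase_ext_eq[of "\<lambda>n. s n * r n"])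
    show "s n * r n \<in> C" for n by (intro mult_C s r)
    have "\<theta> (s n * r n) = (\<lambda>x. \<theta> (s n) x * \<theta> (r n) x)" for n
      using theta_mult s r by blast
    then show "uniform_limit UNIV (\<lambda>n. \<theta> (s n * r n)) (\<lambda>x. f x * g x) sequentially"
      using uniform_lim_mult[OF s(2) r(2) bounded[OF assms(1)] bounded[OF assms(2)]] by simp
    show "(\<lambda>n. s n * r n) \<longlonglongrightarrow> \<iota> f * \<iota> g" by (intro tendsto_mult s r)
  qed
qed

lemma phase_ext_const: "\<iota> (\<lambda>x. t) = t *\<^sub>R 1"
proof -
  have "\<theta> (t *\<^sub>R 1) = (\<lambda>x. t)" using theta_const by blast
  then show ?thesis using phase_ext_theta[OF scale_one_C, of t] by simp
qed

lemma phase_ext_scale: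
  assumes "continuous_on UNIV f"
  shows "\<iota> (\<lambda>x. t * f x) = t *\<^sub>R \<iota> f"
  using phase_ext_mult[of "\<lambda>x. t" f] assms by (simp add: phase_ext_const)

lemma phase_ext_diff:
  assumes "continuous_on UNIV f" "continuous_on UNIV g"
  shows "\<iota> (\<lambda>x. f x - g x) = \<iota> f - \<iota> g"
  using phase_ext_add[of f "\<lambda>x. (-1) * g x"] phase_ext_scale[of g "-1"] assms
  by (simp add: continuous_on_minus)

lemma phase_ext_sum:
  assumes "\<And>i. i \<in> I \<Longrightarrow> continuous_on UNIV (f i)"
  shows "\<iota> (\<lambda>x. \<Sum>i\<in>I. f i x) = (\<Sum>i\<in>I. \<iota> (f i))"
  using assms
proof (induction I rule: infinite_finite_induct)
  case (insert i I)
  then show ?case by (simp add: phase_ext_add continuous_on_sum)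
qed (simp_all add: phase_ext_const)

text \<open>Approximants of \<open>f\<close> may dip below zero, so \<open>e\<close> is added to
  bring them into \<open>P\<close>. Closedness of \<open>P\<close> is used twice: along the
  approximants, and then for \<open>e\<close> tending to 0.\<close>

lemma phase_ext_nonneg:
  assumes f: "continuous_on UNIV f" "\<And>x. 0 \<le> f x"
  shows "\<iota> f \<in> P"
proof -
  obtain s where s: "\<And>n. s n \<in> C" "uniform_limit UNIV (\<lambda>n. \<theta> (s n)) f sequentially" "s \<longlonglongrightarrow> \<iota> f"
    using phase_ext_approx[OF f(1)] by blast
  have "\<iota> f + e *\<^sub>R 1 \<in> P" if "0 < e" for e
  proof (rule Lim_in_closed_set[OF closed_P])
    show "\<forall>\<^sub>F n in sequentially. s n + e *\<^sub>R 1 \<in> P"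
      using uniform_limitD[OF s(2) that]
    proof eventually_elim
      case (elim n)
      have "s n + e *\<^sub>R 1 \<in> C" by (intro subspace_add subspace_C s scale_one_C)
      moreover have "0 \<le> \<theta> (s n + e *\<^sub>R 1) x" for x
      proof -
        have "\<bar>\<theta> (s n) x - f x\<bar> < e" using elim by (simp add: dist_real_def)
        then show ?thesis
          using f(2)[of x] unfolding theta_add[OF s(1) scale_one_C] theta_const by linarith
      qed
      ultimately show ?case by (simp add: theta_pos_iff)
    qed
    show "(\<lambda>n. s n + e *\<^sub>R 1) \<longlonglongrightarrow> \<iota> f + e *\<^sub>R 1" by (intro tendsto_intros s)
  qed simp
  then have "\<forall>\<^sub>F n in sequentially. \<iota> f + inverse (real (Suc n)) *\<^sub>R 1 \<in> P" by simp
  moreover have "(\<lambda>n. \<iota> f + inverse (real (Suc n)) *\<^sub>R 1) \<longlonglongrightarrow> \<iota> f + 0 *\<^sub>R 1"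
    by (intro tendsto_intros LIMSEQ_inverse_real_of_nat)
  ultimately show ?thesis
    using Lim_in_closed_set[OF closed_P] by fastforce
qed

lemma E_power_P: "E ^ n \<in> P"
  by (rule power_P[OF E_in_P])

lemma phase_ext_power_mono:
  assumes f: "continuous_on UNIV f" "\<And>x. 0 \<le> f x" and g: "continuous_on UNIV g" "\<And>x. f x \<le> g x"
  shows "norm (\<iota> f * E ^ n) \<le> norm (\<iota> g * E ^ n)"
proof (rule norm_mono)
  show "\<iota> f * E ^ n \<in> P"
    by (intro mult_P phase_ext_nonneg f E_power_P)
  have "\<iota> (\<lambda>x. g x - f x) * E ^ n \<in> P"
    by (intro mult_P phase_ext_nonneg E_power_P continuous_on_diff f g) (simp add: g)
  then show "\<iota> g * E ^ n - \<iota> f * E ^ n \<in> P"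
    by (simp add: phase_ext_diff f g left_diff_distrib)
qed

end

section \<open>Monomials of the crossed algebra\<close>

lemma crossed_term_mult:
  assumes "continuous_on UNIV F" "continuous_on UNIV G"
  shows "crossed_term F m * crossed_term G n = crossed_term (\<lambda>x. F x * G ((shift ^^ m) x)) (m + n)"
proof (rule crossed_eqI)
  fix k x
  have cont: "continuous_on UNIV (\<lambda>x. F x * G ((shift ^^ m) x))"
    using continuous_on_mult[OF assms(1) continuous_on_compose2[OF assms(2) continuous_on_shift_funpow]]
    by simp
  have "coeff (crossed_term F m * crossed_term G n) k x =
      (\<Sum>i\<le>k. if i = m then (if k - m = n then F x * G ((shift ^^ m) x) else 0) else 0)"
    unfolding coeff_times coeff_crossed_term[OF assms(1)] coeff_crossed_term[OF assms(2)]
    by (intro sum.cong) auto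
  also have "\<dots> = (if k = m + n then F x * G ((shift ^^ m) x) else 0)"
    by auto
  finally show "coeff (crossed_term F m * crossed_term G n) k x =
      coeff (crossed_term (\<lambda>x. F x * G ((shift ^^ m) x)) (m + n)) k x"
    by (simp only: coeff_crossed_term[OF cont])
qed

text \<open>A monomial splits into degree-one factors because \<open>E ^ i\<close> carries a
  function of the first coordinate to coordinate \<open>i\<close>. This reduces its evaluation to
  degree one.\<close>

lemma crossed_term_products:
  fixes f :: "nat \<Rightarrow> 'x::topological_space \<Rightarrow> real"
  assumes "\<And>i. i < n \<Longrightarrow> continuous_on UNIV (f i)"
  shows "crossed_term (\<lambda>x. \<Prod>i<n. f i (x i)) n =
    prod_list (map (\<lambda>i. crossed_term (\<lambda>x. f i (x 0)) 1) [0..<n])"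
  using assms
proof (induction n)
  case 0
  then show ?case by (simp add: one_crossed_def)
next
  case (Suc n)
  have "continuous_on UNIV (\<lambda>x::nat \<Rightarrow> 'x. f n (x 0))"
    using continuous_on_compose2[OF Suc.prems[of n] continuous_on_product_coordinates] by simp
  moreover have "continuous_on UNIV (\<lambda>x. \<Prod>i<n. f i (x i))"
    using Suc.prems by (intro continuous_on_product_fun) simp
  ultimately have "crossed_term (\<lambda>x. (\<Prod>i<n. f i (x i)) * f n (x n)) (n + 1) =
      crossed_term (\<lambda>x. \<Prod>i<n. f i (x i)) n * crossed_term (\<lambda>x. f n (x 0)) 1"
    by (simp add: crossed_term_mult shift_funpow)
  with Suc show ?case by simp
qed

lemma crossed_term_add:
  assumes "continuous_on UNIV F" "continuous_on UNIV G"
  shows "crossed_term (\<lambda>x. F x + G x) n = crossed_term F n + crossed_term G n"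
  by (rule crossed_eqI)
    (simp add: coeff_plus coeff_crossed_term[OF assms(1)] coeff_crossed_term[OF assms(2)]
      coeff_crossed_term[OF continuous_on_add[OF assms]])

lemma crossed_term_scale:
  assumes "continuous_on UNIV F"
  shows "crossed_term (\<lambda>x. t * F x) n = t *\<^sub>R crossed_term F n"
  by (rule crossed_eqI)
    (simp add: coeff_scaleR coeff_crossed_term[OF assms]
      coeff_crossed_term[OF continuous_on_mult_left[OF assms]])

lemma crossed_term_diff:
  assumes "continuous_on UNIV F" "continuous_on UNIV G"
  shows "crossed_term (\<lambda>x. F x - G x) n = crossed_term F n - crossed_term G n"
  by (rule crossed_eqI)
    (simp add: coeff_minus coeff_crossed_term[OF assms(1)] coeff_crossed_term[OF assms(2)]
      coeff_crossed_term[OF continuous_on_diff[OF assms]])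

lemma crossed_term_proper:
  assumes "continuous_on UNIV F" "depends_on_first n F"
  shows "crossed_term F n \<in> proper"
proof -
  have "coeff (crossed_term F n) i = (if i = n then F else (\<lambda>x. 0))" for i
    using coeff_crossed_term[OF assms(1)] by auto
  then show ?thesis
    using assms(2) by (simp add: proper_def) (simp add: depends_on_first_def)
qed

lemma crossed_term_pos:
  assumes "continuous_on UNIV F" "\<And>x. 0 \<le> F x"
  shows "crossed_term F n \<in> crossed_pos"
  using assms(2) by (simp add: crossed_pos_def coeff_crossed_term[OF assms(1)])

lemma depends_on_first_const: "depends_on_first n (\<lambda>x. c)"
  by (simp add: depends_on_first_def)

lemma proper_add: "A \<in> proper \<Longrightarrow> B \<in> proper \<Longrightarrow> A + B \<in> proper"
  by (simp add: proper_def depends_on_first_def coeff_plus, metis)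

lemma proper_diff: "A \<in> proper \<Longrightarrow> B \<in> proper \<Longrightarrow> A - B \<in> proper"
  by (simp add: proper_def depends_on_first_def coeff_minus, metis)

lemma proper_scale: "A \<in> proper \<Longrightarrow> t *\<^sub>R A \<in> proper"
  by (simp add: proper_def depends_on_first_def coeff_scaleR)

text \<open>Commuting each \<open>E\<close> to the right composes the next weight with the shift.
  For \<open>H = exp \<circ> \<phi>\<close> the coefficient is the exponential of a Birkhoff
  sum.\<close>

lemma crossed_term_power:
  assumes H: "continuous_on UNIV H"
  shows "crossed_term H 1 ^ n = crossed_term (\<lambda>x. \<Prod>k<n. H ((shift ^^ k) x)) n"
proof (induction n)
  case 0
  then show ?case by (simp add: one_crossed_def)
next
  case (Suc n)
  have "continuous_on UNIV (\<lambda>x. \<Prod>k<n. H ((shift ^^ k) x))"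
    by (intro continuous_on_prod)
      (use continuous_on_compose2[OF H continuous_on_shift_funpow] in simp)
  then have "crossed_term H 1 ^ Suc n =
      crossed_term (\<lambda>x. (\<Prod>k<n. H ((shift ^^ k) x)) * H ((shift ^^ n) x)) (n + 1)"
    using crossed_term_mult[OF _ H] by (simp only: power_Suc2 Suc)
  then show ?case by simp
qed

section \<open>The map of the phase space\<close>

lemma (in positive_process) theta_separates:
  assumes "x \<noteq> y"
  obtains a where "a \<in> C" "\<theta> a x \<noteq> \<theta> a y"
proof -
  obtain f :: "'x \<Rightarrow> real" where f: "continuous_on UNIV f" "f x \<noteq> f y"
    using urysohn_separates[OF compact_X assms] by metis
  \<comment> \<open>Half the gap: two errors below \<open>e\<close> cannot bridge \<open>f x\<close>
    and \<open>f y\<close>.\<close>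
  define e where "e = \<bar>f x - f y\<bar> / 2"
  have "0 < e" using f(2) by (simp add: e_def)
  then obtain a where a: "a \<in> C" "\<And>x. \<bar>f x - \<theta> a x\<bar> < e"
    using theta_dense[OF f(1)] by blast
  have "\<theta> a x \<noteq> \<theta> a y"
  proof
    assume "\<theta> a x = \<theta> a y"
    then have "\<bar>f x - f y\<bar> < 2 * e" using a(2)[of x] a(2)[of y] by linarith
    then show False by (simp add: e_def)
  qed
  then show ?thesis using that a(1) by blast
qed

context covariant_positive_flow
begin

text \<open>
  If no \<open>y\<close> represented the character \<open>f \<mapsto> \<theta> (\<alpha>s f) x\<close>, then by compactness a finite sum of
  squares would be strictly positive on \<open>X\<close> and yet be annihilated by this positive character.
\<close>

lemma character_is_evaluation: "\<exists>y. \<forall>f\<in>C. \<theta> (\<alpha>s f) x = \<theta> f y"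
proof (rule ccontr)
  assume "\<nexists>y. \<forall>f\<in>C. \<theta> (\<alpha>s f) x = \<theta> f y"
  then have "\<forall>y. \<exists>f\<in>C. \<theta> (\<alpha>s f) x \<noteq> \<theta> f y" by blast
  then obtain h where h: "\<And>y. h y \<in> C" "\<And>y. \<theta> (\<alpha>s (h y)) x \<noteq> \<theta> (h y) y"
    by metis
  \<comment> \<open>Subtracting the value of the character puts \<open>k y\<close> into its kernel;
    the square \<open>g y\<close> stays there, is nonnegative everywhere and positive at
    \<open>y\<close>.\<close>
  define k where "k y = h y - \<theta> (\<alpha>s (h y)) x *\<^sub>R 1" for y
  define g where "g y = k y * k y" for y
  have k_C: "k y \<in> C" for y
    unfolding k_def by (intro subspace_diff subspace_C h scale_one_C)
  have k_theta: "\<theta> (k y) z = \<theta> (h y) z - \<theta> (\<alpha>s (h y)) x" for y z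
    unfolding k_def by (simp add: theta_diff h scale_one_C theta_const)
  have g_C: "g y \<in> C" for y unfolding g_def by (intro mult_C k_C)
  have g_theta: "\<theta> (g y) z = (\<theta> (h y) z - \<theta> (\<alpha>s (h y)) x)\<^sup>2" for y z
    unfolding g_def theta_mult[OF k_C k_C] k_theta by (simp add: power2_eq_square)
  have k_alpha: "\<theta> (\<alpha>s (k y)) x = 0" for y
  proof -
    have "h y = k y + \<theta> (\<alpha>s (h y)) x *\<^sub>R 1" by (simp add: k_def)
    then have "\<alpha>s (h y) = \<alpha>s (k y) + \<theta> (\<alpha>s (h y)) x *\<^sub>R 1"
      by (metis \<alpha>s_add \<alpha>s_one \<alpha>s_scale k_C one_C scale_one_C)
    then have "\<theta> (\<alpha>s (h y)) x = \<theta> (\<alpha>s (k y)) x + \<theta> (\<alpha>s (h y)) x"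
      by (metis \<alpha>s_in k_C scale_one_C theta_add theta_const)
    then show ?thesis by simp
  qed
  have g_alpha: "\<theta> (\<alpha>s (g y)) x = 0" for y
    unfolding g_def by (simp add: \<alpha>s_mult k_C theta_mult \<alpha>s_in k_alpha)
  have "\<exists>D\<subseteq>UNIV. finite D \<and> UNIV \<subseteq> (\<Union>y\<in>D. {z. 0 < \<theta> (g y) z})"
  proof (rule compactE_image[OF compact_X, of UNIV "\<lambda>y. {z. 0 < \<theta> (g y) z}"])
    show "open {z. 0 < \<theta> (g y) z}" for y
      by (intro open_Collect_less continuous_on_const continuous_theta g_C)
    have "y \<in> {z. 0 < \<theta> (g y) z}" for y
      using h(2)[of y] by (simp add: g_theta)
    then show "UNIV \<subseteq> (\<Union>y. {z. 0 < \<theta> (g y) z})" by blast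
  qed blast
  then obtain D where D: "finite D" "\<And>z. \<exists>y\<in>D. 0 < \<theta> (g y) z" by blast
  have sums: "sum g D \<in> C \<and> \<theta> (sum g D) z = (\<Sum>y\<in>D. \<theta> (g y) z) \<and> \<theta> (\<alpha>s (sum g D)) x = 0"
    if "finite D" for D z
    using that
  proof (induction D rule: finite_induct)
    case empty
    then show ?case
      using theta_const[of 0] \<alpha>s_scale[OF one_C, of 0] scale_one_C[of 0] by simp
  next
    case (insert y D)
    then show ?case
      by (simp add: theta_add g_C \<alpha>s_add \<alpha>s_in g_alpha subspace_add[OF subspace_C])
  qed
  have S_C: "sum g D \<in> C" and S_theta: "\<theta> (sum g D) z = (\<Sum>y\<in>D. \<theta> (g y) z)"
    and S_alpha: "\<theta> (\<alpha>s (sum g D)) x = 0" for z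
    using sums[OF D(1)] by auto
  have "0 < \<theta> (sum g D) z" for z
  proof -
    obtain y where "y \<in> D" "0 < \<theta> (g y) z" using D(2) by blast
    then show ?thesis
      unfolding S_theta using D(1) by (intro sum_pos2[of D y]) (auto simp: g_theta)
  qed
  then obtain d where d: "0 < d" "\<And>z. d \<le> \<theta> (sum g D) z"
    using compact_UNIV_positive_lower_bound[OF compact_X continuous_theta[OF S_C]] by metis
  \<comment> \<open>The difference is still positive, so the character would take at least the value
    \<open>d\<close> on the sum that it annihilates.\<close>
  have diff_C: "sum g D - d *\<^sub>R 1 \<in> C" by (intro subspace_diff subspace_C S_C scale_one_C)
  have "sum g D - d *\<^sub>R 1 \<in> P"
    using d(2) by (simp add: theta_pos_iff[OF diff_C] theta_diff S_C scale_one_C theta_const)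
  then have "0 \<le> \<theta> (\<alpha>s (sum g D - d *\<^sub>R 1)) x"
    using \<alpha>s_pos[OF diff_C] theta_pos_iff[OF \<alpha>s_in[OF diff_C]] by blast
  moreover have "\<alpha>s (sum g D) = \<alpha>s (sum g D - d *\<^sub>R 1) + d *\<^sub>R 1"
    using \<alpha>s_add[OF diff_C scale_one_C, of d] by (simp add: \<alpha>s_scale one_C \<alpha>s_one)
  then have "\<theta> (\<alpha>s (sum g D)) x = \<theta> (\<alpha>s (sum g D - d *\<^sub>R 1)) x + d"
    by (simp add: theta_add \<alpha>s_in diff_C scale_one_C theta_const)
  ultimately show False using S_alpha \<open>0 < d\<close> by simp
qed

text \<open>A bump at \<open>\<alpha> x\<close> vanishing off \<open>U\<close> is approximated by
  \<open>\<theta> a\<close> within 1/2. Where \<open>\<theta> (\<alpha>s a)\<close> exceeds 1/2, the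
  bump is nonzero at the image point, so this open set maps into \<open>U\<close>.\<close>

lemma continuous_dual_map:
  fixes \<alpha> :: "'x \<Rightarrow> 'x"
  assumes "\<And>f x. f \<in> C \<Longrightarrow> \<theta> (\<alpha>s f) x = \<theta> f (\<alpha> x)"
  shows "continuous_on UNIV \<alpha>"
  unfolding continuous_on_open_vimage[OF open_UNIV]
proof (intro allI impI)
  fix U :: "'x set" assume "open U"
  have "\<exists>T. open T \<and> x \<in> T \<and> T \<subseteq> \<alpha> -` U" if xU: "\<alpha> x \<in> U" for x
  proof -
    obtain f :: "'x \<Rightarrow> real" where f: "continuous_on UNIV f" "f (\<alpha> x) = 1" "\<And>y. y \<notin> U \<Longrightarrow> f y = 0"
      using urysohn_function[OF compact_X \<open>open U\<close> xU] by metis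
    obtain a where a: "a \<in> C" "\<And>y. \<bar>f y - \<theta> a y\<bar> < 1/2"
      using theta_dense[OF f(1), of "1/2"] by auto
    let ?T = "{z. 1/2 < \<theta> (\<alpha>s a) z}"
    have "open ?T"
      by (intro open_Collect_less continuous_on_const continuous_theta \<alpha>s_in a)
    moreover have "x \<in> ?T"
      using a(2)[of "\<alpha> x"] f(2) by (simp add: assms a(1) abs_if split: if_splits)
    moreover have "?T \<subseteq> \<alpha> -` U"
    proof
      fix z assume "z \<in> ?T"
      then have "f (\<alpha> z) \<noteq> 0" using a(2)[of "\<alpha> z"] by (auto simp: assms a(1))
      then show "z \<in> \<alpha> -` U" using f(3) by auto
    qed
    ultimately show ?thesis by blast
  qed
  then show "open (\<alpha> -` U \<inter> UNIV)"
    by (subst open_subopen) auto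
qed

abbreviation \<alpha> :: "'x \<Rightarrow> 'x" where "\<alpha> \<equiv> flow_map C \<theta> \<alpha>s"

text \<open>The \<open>THE\<close> in \<open>flow_map\<close> is legitimate: the points representing
  the characters form a map, which is continuous by \<open>continuous_dual_map\<close>, and
  separation of points by \<open>C\<close> makes it unique.\<close>

lemma
  shows continuous_flow_map: "continuous_on UNIV \<alpha>"
    and theta_flow_map: "f \<in> C \<Longrightarrow> \<theta> (\<alpha>s f) = \<theta> f \<circ> \<alpha>"
proof -
  obtain \<beta> where \<beta>: "\<And>f x. f \<in> C \<Longrightarrow> \<theta> (\<alpha>s f) x = \<theta> f (\<beta> x)"
    using character_is_evaluation by metis
  have "\<exists>!\<alpha>. continuous_on UNIV \<alpha> \<and> (\<forall>f\<in>C. \<theta> (\<alpha>s f) = \<theta> f \<circ> \<alpha>)"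
  proof (rule ex1I[of _ \<beta>])
    show "continuous_on UNIV \<beta> \<and> (\<forall>f\<in>C. \<theta> (\<alpha>s f) = \<theta> f \<circ> \<beta>)"
      using continuous_dual_map[OF \<beta>] \<beta> by auto
    fix \<gamma> assume \<gamma>: "continuous_on UNIV \<gamma> \<and> (\<forall>f\<in>C. \<theta> (\<alpha>s f) = \<theta> f \<circ> \<gamma>)"
    show "\<gamma> = \<beta>"
    proof
      fix x
      have "\<theta> f (\<gamma> x) = \<theta> f (\<beta> x)" if "f \<in> C" for f
        using \<gamma> \<beta>[OF that, of x] that by simp
      then show "\<gamma> x = \<beta> x" using theta_separates by metis
    qed
  qed
  from theI'[OF this] show "continuous_on UNIV \<alpha>" "f \<in> C \<Longrightarrow> \<theta> (\<alpha>s f) = \<theta> f \<circ> \<alpha>"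
    unfolding flow_map_def by blast+
qed

section \<open>Commutation of \<open>E\<close> with all continuous functions\<close>

lemma continuous_flow_map_funpow: "continuous_on UNIV (\<alpha> ^^ n)"
proof (induction n)
  case (Suc n)
  then show ?case
    using continuous_on_compose[OF Suc continuous_on_subset[OF continuous_flow_map]] by simp
qed (simp add: id_def continuous_on_id)

lemma continuous_on_compose_funpow:
  "continuous_on UNIV f \<Longrightarrow> continuous_on UNIV (\<lambda>x. f ((\<alpha> ^^ n) x))"
  using continuous_on_compose2[OF _ continuous_flow_map_funpow] by blast

text \<open>Covariance is given on \<open>C\<close>; approximants of \<open>f\<close> carry the
  relation to the limit.\<close>

lemma E_phase_ext:
  assumes f: "continuous_on UNIV f"
  shows "E * \<iota> f = \<iota> (\<lambda>x. f (\<alpha> x)) * E"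
proof -
  obtain s where s: "\<And>n. s n \<in> C" "uniform_limit UNIV (\<lambda>n. \<theta> (s n)) f sequentially" "s \<longlonglongrightarrow> \<iota> f"
    using phase_ext_approx[OF f] by blast
  have lim: "uniform_limit UNIV (\<lambda>n. \<theta> (\<alpha>s (s n))) (\<lambda>x. f (\<alpha> x)) sequentially"
    unfolding theta_flow_map[OF s(1)] comp_def
    by (rule uniform_limit_compose'[OF s(2)]) simp
  have cont: "continuous_on UNIV (\<lambda>x. f (\<alpha> x))"
    using continuous_on_compose_funpow[OF f, of 1] by simp
  obtain r where r: "\<And>n. r n \<in> C" "uniform_limit UNIV (\<lambda>n. \<theta> (r n)) (\<lambda>x. f (\<alpha> x)) sequentially"
      "r \<longlonglongrightarrow> \<iota> (\<lambda>x. f (\<alpha> x))"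
    using phase_ext_approx[OF cont] by blast
  \<comment> \<open>Uniform convergence of the images determines their norm limit by merging with
    \<open>r\<close>, whose norm limit is known.\<close>
  have "(\<lambda>n. \<alpha>s (s n)) \<longlonglongrightarrow> \<iota> (\<lambda>x. f (\<alpha> x))"
    using tendsto_add[OF uniform_limits_merge[OF \<alpha>s_in[OF s(1)] lim r(1,2)] r(3)] by simp
  then have "(\<lambda>n. \<alpha>s (s n) * E) \<longlonglongrightarrow> \<iota> (\<lambda>x. f (\<alpha> x)) * E"
    by (intro tendsto_intros)
  moreover have "(\<lambda>n. \<alpha>s (s n) * E) \<longlonglongrightarrow> E * \<iota> f"
    using tendsto_mult_left[OF s(3), of E] covariant[OF s(1)] by simp
  ultimately show ?thesis using LIMSEQ_unique by blast
qed

lemma E_power_phase_ext: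
  assumes f: "continuous_on UNIV f"
  shows "E ^ n * \<iota> f = \<iota> (\<lambda>x. f ((\<alpha> ^^ n) x)) * E ^ n"
proof (induction n)
  case (Suc n)
  have "E ^ Suc n * \<iota> f = (E * \<iota> (\<lambda>x. f ((\<alpha> ^^ n) x))) * E ^ n"
    by (simp add: Suc mult.assoc)
  also have "\<dots> = \<iota> (\<lambda>x. f ((\<alpha> ^^ n) (\<alpha> x))) * E ^ Suc n"
    by (simp add: E_phase_ext continuous_on_compose_funpow f mult.assoc)
  finally show ?case by (simp add: funpow_swap1)
qed simp

section \<open>Realization of the crossed algebra over a covariant flow\<close>

abbreviation itin :: "'x \<Rightarrow> nat \<Rightarrow> 'x" where "itin \<equiv> itinerary \<alpha>"

lemma shift_funpow_itinerary: "(shift ^^ n) (itin x) = itin ((\<alpha> ^^ n) x)"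
  by (simp add: shift_funpow itinerary_def funpow_add)

lemma continuous_itinerary: "continuous_on UNIV F \<Longrightarrow> continuous_on UNIV (\<lambda>x. F (itin x))"
  by (rule continuous_on_compose2[of UNIV F UNIV itin])
    (auto simp: itinerary_def intro!: continuous_on_coordinatewise_then_product
      continuous_flow_map_funpow)

text \<open>Only finitely many terms are nonzero; writing them as a series lets the Cauchy product
  deliver multiplicativity.\<close>

definition eval_crossed :: "'x crossed \<Rightarrow> 'a" where
  "eval_crossed A = (\<Sum>i. \<iota> (\<lambda>x. coeff A i (itin x)) * E ^ i)"

lemma eval_crossed_term_zero: "coeff A i = (\<lambda>x. 0) \<Longrightarrow> \<iota> (\<lambda>x. coeff A i (itin x)) * E ^ i = 0"
  by (simp add: phase_ext_const)

lemma eval_crossed_summable: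
  "summable (\<lambda>i. norm (\<iota> (\<lambda>x. coeff A i (itin x)) * E ^ i))"
  by (rule summable_finite[OF finite_coeff[of A]]) (use eval_crossed_term_zero[of A] in force)

lemma eval_crossed_add: "eval_crossed (A + B) = eval_crossed A + eval_crossed B"
  unfolding eval_crossed_def
  by (subst suminf_add[OF summable_norm_cancel summable_norm_cancel,
        OF eval_crossed_summable eval_crossed_summable])
    (simp add: coeff_plus phase_ext_add continuous_itinerary continuous_coeff distrib_right)

lemma eval_crossed_scale: "eval_crossed (t *\<^sub>R A) = t *\<^sub>R eval_crossed A"
  unfolding eval_crossed_def
  by (subst suminf_scaleR_right[OF summable_norm_cancel, OF eval_crossed_summable])
    (simp add: coeff_scaleR phase_ext_scale continuous_itinerary continuous_coeff)

text \<open>Along itineraries the shift becomes \<open>\<alpha>\<close>, and moving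
  \<open>E ^ i\<close> past a function produces the same composition. So the twisted product of
  coefficients turns into the Cauchy product of the two series.\<close>

lemma eval_crossed_mult: "eval_crossed (A * B) = eval_crossed A * eval_crossed B"
proof -
  let ?a = "\<lambda>A i. \<iota> (\<lambda>x. coeff A i (itin x)) * E ^ i"
  have "?a (A * B) k = (\<Sum>i\<le>k. ?a A i * ?a B (k - i))" for k
  proof -
    let ?f = "\<lambda>i x. coeff A i (itin x)" and ?g = "\<lambda>i x. coeff B (k - i) (itin ((\<alpha> ^^ i) x))"
    have f: "continuous_on UNIV (?f i)" for i
      by (rule continuous_itinerary[OF continuous_coeff])
    have g: "continuous_on UNIV (?g i)" for i
      using continuous_on_compose_funpow[OF continuous_itinerary[OF continuous_coeff]] .
    have "?a (A * B) k = (\<Sum>i\<le>k. \<iota> (\<lambda>x. ?f i x * ?g i x)) * E ^ k"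
      unfolding coeff_times shift_funpow_itinerary
      by (subst phase_ext_sum[OF continuous_on_mult[OF f g]]) (rule refl)
    also have "\<dots> = (\<Sum>i\<le>k. ?a A i * ?a B (k - i))"
      unfolding sum_distrib_right
    proof (intro sum.cong refl)
      fix i assume "i \<in> {..k}"
      then have "E ^ k = E ^ i * E ^ (k - i)" by (simp flip: power_add)
      then have "\<iota> (\<lambda>x. ?f i x * ?g i x) * E ^ k = \<iota> (?f i) * (\<iota> (?g i) * E ^ i) * E ^ (k - i)"
        by (simp only: phase_ext_mult[OF f g] mult.assoc)
      also have "\<dots> = ?a A i * ?a B (k - i)"
        by (simp only: E_power_phase_ext[OF continuous_itinerary[OF continuous_coeff], symmetric]
            mult.assoc)
      finally show "\<iota> (\<lambda>x. ?f i x * ?g i x) * E ^ k = ?a A i * ?a B (k - i)" .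
    qed
    finally show ?thesis .
  qed
  then show ?thesis
    unfolding eval_crossed_def Cauchy_product[OF eval_crossed_summable eval_crossed_summable]
    by simp
qed

lemma eval_crossed_term:
  assumes "continuous_on UNIV F"
  shows "eval_crossed (crossed_term F n) = \<iota> (\<lambda>x. F (itin x)) * E ^ n"
proof -
  have "eval_crossed (crossed_term F n) =
      (\<Sum>i\<in>{n}. \<iota> (\<lambda>x. coeff (crossed_term F n) i (itin x)) * E ^ i)"
    unfolding eval_crossed_def
    by (rule suminf_finite) (auto simp: coeff_crossed_term assms phase_ext_const)
  then show ?thesis by (simp add: coeff_crossed_term assms)
qed

lemma eval_crossed_pos:
  assumes "A \<in> crossed_pos"
  shows "eval_crossed A \<in> P"
proof -
  have "eval_crossed A = (\<Sum>i | coeff A i \<noteq> (\<lambda>x. 0). \<iota> (\<lambda>x. coeff A i (itin x)) * E ^ i)"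
    unfolding eval_crossed_def
    by (rule suminf_finite[OF finite_coeff]) (use eval_crossed_term_zero[of A] in blast)
  moreover have "sum f I \<in> P" if "\<And>i. f i \<in> P" for f :: "nat \<Rightarrow> 'a" and I
    using that scale_P[OF one_P, of 0]
    by (induction I rule: infinite_finite_induct) (auto intro: add_P)
  moreover have "\<iota> (\<lambda>x. coeff A i (itin x)) * E ^ i \<in> P" for i
    using assms unfolding crossed_pos_def
    by (intro mult_P phase_ext_nonneg continuous_itinerary continuous_coeff E_power_P) simp
  ultimately show ?thesis by simp
qed

text \<open>Existence of the homomorphism. The prescribed values on products hold because each
  degree-one factor reads only the first coordinate, and the itinerary of \<open>x\<close> starts at
  \<open>x\<close>.\<close>

lemma is_susp_hom_eval_crossed: "is_susp_hom P C \<theta> E eval_crossed"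
proof -
  have "eval_crossed 1 = 1"
    unfolding one_crossed_def by (simp add: eval_crossed_term phase_ext_const)
  moreover have "eval_crossed (crossed_term (\<lambda>x. \<Prod>i<n. f i (x i)) n) =
      prod_list (map (\<lambda>i. \<iota> (f i) * E) [0..<n])"
    if f: "\<And>i. i < n \<Longrightarrow> continuous_on UNIV (f i)" for n f
  proof -
    have "eval_crossed (prod_list As) = prod_list (map eval_crossed As)" for As
      by (induction As) (simp_all add: \<open>eval_crossed 1 = 1\<close> eval_crossed_mult)
    moreover have "eval_crossed (crossed_term (\<lambda>x. f i (x 0)) 1) = \<iota> (f i) * E" if "i < n" for i
    proof -
      have "continuous_on UNIV (\<lambda>x::nat \<Rightarrow> 'x. f i (x 0))"
        using continuous_on_compose2[OF f[OF that] continuous_on_product_coordinates] by simp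
      then show ?thesis by (simp add: eval_crossed_term itinerary_def)
    qed
    then have "map (\<lambda>i. eval_crossed (crossed_term (\<lambda>x. f i (x 0)) 1)) [0..<n] =
        map (\<lambda>i. \<iota> (f i) * E) [0..<n]"
      by (intro map_cong) auto
    ultimately show ?thesis
      by (simp only: crossed_term_products[OF f] map_map comp_def)
  qed
  ultimately show ?thesis
    unfolding is_susp_hom_def
    by (auto simp: eval_crossed_add eval_crossed_scale eval_crossed_mult eval_crossed_pos)
qed

end

section \<open>Uniqueness of the homomorphism on proper operators\<close>

context positive_process
begin

context
  fixes \<pi> :: "'x crossed \<Rightarrow> 'a"
  assumes \<pi>: "is_susp_hom P C \<theta> E \<pi>"
begin

lemma
  shows susp_hom_add: "A \<in> proper \<Longrightarrow> B \<in> proper \<Longrightarrow> \<pi> (A + B) = \<pi> A + \<pi> B"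
    and susp_hom_scale: "A \<in> proper \<Longrightarrow> \<pi> (t *\<^sub>R A) = t *\<^sub>R \<pi> A"
    and susp_hom_pos: "A \<in> proper \<Longrightarrow> A \<in> crossed_pos \<Longrightarrow> \<pi> A \<in> P"
    and susp_hom_prod: "(\<And>i. i < n \<Longrightarrow> continuous_on UNIV (f i)) \<Longrightarrow>
        \<pi> (crossed_term (\<lambda>x. \<Prod>i<n. f i (x i)) n) =
        prod_list (map (\<lambda>i. \<iota> (f i) * E) [0..<n])"
  using \<pi> unfolding is_susp_hom_def by blast+

lemma susp_hom_diff:
  assumes "A \<in> proper" "B \<in> proper"
  shows "\<pi> (A - B) = \<pi> A - \<pi> B"
  using susp_hom_add[OF proper_diff[OF assms] assms(2)] by simp

text \<open>The shift argument again, with the monomial \<open>E ^ n\<close> in place of the unit: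
  \<open>F E^n\<close> lies between \<open>- e\<close> and \<open>e\<close> times that monomial, and
  positivity of \<open>\<pi>\<close> preserves this.\<close>

lemma susp_hom_term_bound:
  assumes F: "continuous_on UNIV F" "depends_on_first n F" and bound: "\<And>x. \<bar>F x\<bar> \<le> e"
  shows "norm (\<pi> (crossed_term F n)) \<le> 3 * e * norm (\<pi> (crossed_term (\<lambda>x. 1) n))"
proof -
  let ?T = "crossed_term (\<lambda>x. 1) n :: 'x crossed" and ?F = "crossed_term F n"
  have "0 \<le> e" using bound[of undefined] by linarith
  have F_proper: "?F \<in> proper" by (rule crossed_term_proper[OF F])
  have T_proper: "?T \<in> proper"
    by (rule crossed_term_proper) (simp_all add: depends_on_first_const)
  have eT: "crossed_term (\<lambda>x. e) n = e *\<^sub>R ?T"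
    using crossed_term_scale[of "\<lambda>x. 1" e n] by simp
  have pm: "- e \<le> F x" "F x \<le> e" for x
    using bound[of x] by (auto simp: abs_le_iff)
  have nonneg: "0 \<le> F x + e" "0 \<le> e - F x" for x
    using pm[of x] by linarith+
  have "?F + e *\<^sub>R ?T \<in> crossed_pos"
    using crossed_term_pos[of "\<lambda>x. F x + e" n] nonneg(1) F(1)
    by (simp add: crossed_term_add continuous_on_add eT)
  then have u: "\<pi> ?F + e *\<^sub>R \<pi> ?T \<in> P"
    using susp_hom_pos[of "?F + e *\<^sub>R ?T"] F_proper T_proper
    by (simp add: proper_add proper_scale susp_hom_add susp_hom_scale)
  have "e *\<^sub>R ?T - ?F \<in> crossed_pos"
    using crossed_term_pos[of "\<lambda>x. e - F x" n] nonneg(2) F(1)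
    by (simp add: crossed_term_diff continuous_on_diff eT)
  then have v: "e *\<^sub>R \<pi> ?T - \<pi> ?F \<in> P"
    using susp_hom_pos[of "e *\<^sub>R ?T - ?F"] F_proper T_proper
    by (simp add: proper_diff proper_scale susp_hom_diff susp_hom_scale)
  have "norm (\<pi> ?F + e *\<^sub>R \<pi> ?T) \<le> norm ((2 * e) *\<^sub>R \<pi> ?T)"
    using norm_mono_P[OF u v] by (simp add: scaleR_2 flip: scaleR_scaleR)
  then have "norm (\<pi> ?F + e *\<^sub>R \<pi> ?T) \<le> 2 * e * norm (\<pi> ?T)"
    using \<open>0 \<le> e\<close> by simp
  then show ?thesis
    using norm_triangle_ineq4[of "\<pi> ?F + e *\<^sub>R \<pi> ?T" "e *\<^sub>R \<pi> ?T"] \<open>0 \<le> e\<close> by simp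
qed

end

text \<open>Both values are prescribed on products, and linearity extends the agreement to the span.
  \<open>susp_hom_term_bound\<close> makes both homomorphisms continuous in degree \<open>n\<close>,
  so density of the span settles the rest.\<close>

lemma susp_hom_unique_on_terms:
  assumes \<pi>: "is_susp_hom P C \<theta> E \<pi>" and \<rho>: "is_susp_hom P C \<theta> E \<rho>"
    and F: "continuous_on UNIV F" "depends_on_first n F"
  shows "\<pi> (crossed_term F n) = \<rho> (crossed_term F n)"
proof -
  have span: "\<pi> (crossed_term G n) = \<rho> (crossed_term G n)" if "product_span n G" for G
    using that
  proof (induction rule: product_span.induct)
    case (product f c)
    let ?G = "\<lambda>x. \<Prod>i<n. f i (x i)"
    have G: "continuous_on UNIV ?G"
      using product by (rule continuous_on_product_fun)
    have "depends_on_first n ?G"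
      unfolding depends_on_first_def by (auto intro!: prod.cong)
    with G have "crossed_term ?G n \<in> proper" by (rule crossed_term_proper)
    then show ?case
      unfolding crossed_term_scale[OF G]
      using susp_hom_prod[OF \<pi> product] susp_hom_prod[OF \<rho> product]
      by (simp add: susp_hom_scale[OF \<pi>] susp_hom_scale[OF \<rho>])
  next
    case (sum G H)
    note [simp] = product_span_continuous[OF sum(1)] product_span_continuous[OF sum(2)]
      product_span_depends[OF sum(1)] product_span_depends[OF sum(2)]
    show ?case
      by (simp add: crossed_term_add susp_hom_add[OF \<pi>] susp_hom_add[OF \<rho>]
          crossed_term_proper sum(3,4))
  qed
  define K where "K = norm (\<pi> (crossed_term (\<lambda>x. 1) n)) + norm (\<rho> (crossed_term (\<lambda>x. 1) n))"
  have bound: "norm (\<pi> (crossed_term F n) - \<rho> (crossed_term F n)) \<le> e * (3 * K)" if e: "0 < e" for e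
  proof -
    obtain G where G: "product_span n G" "\<And>x. \<bar>F x - G x\<bar> < e"
      using product_span_dense[OF compact_X F e] by metis
    note GC = product_span_continuous[OF G(1)] and GD = product_span_depends[OF G(1)]
    have D: "continuous_on UNIV (\<lambda>x. F x - G x)" "depends_on_first n (\<lambda>x. F x - G x)"
      using continuous_on_diff[OF F(1) GC] depends_on_first_map2[OF F(2) GD, of "(-)"] by simp_all
    note P1 = crossed_term_proper[OF F] and P2 = crossed_term_proper[OF GC GD]
    have "\<pi> (crossed_term F n) - \<rho> (crossed_term F n) =
        \<pi> (crossed_term (\<lambda>x. F x - G x) n) - \<rho> (crossed_term (\<lambda>x. F x - G x) n)"
      by (simp add: crossed_term_diff[OF F(1) GC] susp_hom_diff[OF \<pi> P1 P2]
          susp_hom_diff[OF \<rho> P1 P2] span[OF G(1)])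
    also have "norm \<dots> \<le> norm (\<pi> (crossed_term (\<lambda>x. F x - G x) n)) +
        norm (\<rho> (crossed_term (\<lambda>x. F x - G x) n))"
      by (rule norm_triangle_ineq4)
    also have "\<dots> \<le> 3 * e * norm (\<pi> (crossed_term (\<lambda>x. 1) n)) +
        3 * e * norm (\<rho> (crossed_term (\<lambda>x. 1) n))"
      by (intro add_mono susp_hom_term_bound[OF \<pi>] susp_hom_term_bound[OF \<rho>] D
          less_imp_le[OF G(2)])
    finally show ?thesis by (simp add: K_def algebra_simps)
  qed
  have "norm (\<pi> (crossed_term F n) - \<rho> (crossed_term F n)) \<le> 0"
  proof (rule field_le_epsilon)
    fix e :: real assume "0 < e"
    have "0 \<le> K" by (simp add: K_def)
    \<comment> \<open>The summand 1 avoids a zero denominator when \<open>K = 0\<close>.\<close>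
    then have "e / (3 * K + 1) * (3 * K) \<le> e" "0 < e / (3 * K + 1)"
      using \<open>0 < e\<close> by (simp_all add: field_simps)
    with bound[of "e / (3 * K + 1)"]
    show "norm (\<pi> (crossed_term F n) - \<rho> (crossed_term F n)) \<le> 0 + e" by linarith
  qed
  then show ?thesis by simp
qed

end

section \<open>The seminorm of monomials\<close>

locale suspended_flow = covariant_positive_flow P C \<theta> E \<alpha>s
  for P C :: "'a::{real_normed_algebra_1,banach} set"
    and \<theta> :: "'a \<Rightarrow> 'x::t2_space \<Rightarrow> real" and E :: 'a and \<alpha>s :: "'a \<Rightarrow> 'a" +
  fixes q :: "'x crossed \<Rightarrow> 'b::{real_normed_algebra_1,banach}"
  assumes suspension: "suspension_completion P C \<theta> E q"
begin

section \<open>The completion map and the chosen homomorphism\<close>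

lemma
  shows q_linear: "linear q" and q_mult: "q (A * B) = q A * q B" and q_one: "q 1 = 1"
    and norm_q: "norm (q A) = susp_seminorm P C \<theta> E A"
  using suspension unfolding suspension_completion_def by blast+

lemma q_power: "q (A ^ n) = q A ^ n"
  by (induction n) (simp_all add: q_one q_mult)

abbreviation \<pi> :: "'x crossed \<Rightarrow> 'a" where "\<pi> \<equiv> susp_hom P C \<theta> E"

lemma is_susp_hom: "is_susp_hom P C \<theta> E \<pi>"
  unfolding susp_hom_def by (rule someI[of "is_susp_hom P C \<theta> E", OF is_susp_hom_eval_crossed])

text \<open>\<open>SOME\<close> may choose any homomorphism, but uniqueness forces its values on
  proper monomials to be those of \<open>eval_crossed\<close>.\<close>

lemma susp_hom_term:
  assumes "continuous_on UNIV F" "depends_on_first n F"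
  shows "\<pi> (crossed_term F n) = \<iota> (\<lambda>x. F (itin x)) * E ^ n"
  using susp_hom_unique_on_terms[OF is_susp_hom is_susp_hom_eval_crossed assms]
    eval_crossed_term[OF assms(1)] by simp

lemma norm_q_le:
  assumes "A \<in> crossed_pos" "A' \<in> proper" "A' - A \<in> crossed_pos"
  shows "norm (q A) \<le> norm (\<pi> A')"
proof -
  have "Inf {norm (\<pi> A') | A'. A' \<in> proper \<and> A' - A \<in> crossed_pos} \<le> norm (\<pi> A')"
    by (rule cInf_lower) (use assms in \<open>auto intro!: bdd_belowI[of _ 0]\<close>)
  then show ?thesis by (simp add: norm_q susp_seminorm_def susp_norm_pos_def assms(1))
qed

text \<open>Hypothesis \<open>ex\<close> keeps the infimum away from the empty set, where
  \<open>Inf\<close> on the reals is unspecified.\<close>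

lemma norm_q_ge:
  assumes A: "A \<in> crossed_pos" and ex: "\<exists>A'. A' \<in> proper \<and> A' - A \<in> crossed_pos"
    and le: "\<And>A'. A' \<in> proper \<Longrightarrow> A' - A \<in> crossed_pos \<Longrightarrow> c \<le> norm (\<pi> A')"
  shows "c \<le> norm (q A)"
proof -
  have "c \<le> Inf {norm (\<pi> A') | A'. A' \<in> proper \<and> A' - A \<in> crossed_pos}"
    by (rule cInf_greatest) (use ex le in auto)
  then show ?thesis by (simp add: norm_q susp_seminorm_def susp_norm_pos_def A)
qed

lemma norm_q_term_le:
  assumes F: "continuous_on UNIV F" "\<And>x. 0 \<le> F x"
    and G: "continuous_on UNIV G" "depends_on_first n G" "\<And>x. F x \<le> G x"
  shows "norm (q (crossed_term F n)) \<le> norm (\<iota> (\<lambda>x. G (itin x)) * E ^ n)"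
proof -
  have "crossed_term G n - crossed_term F n \<in> crossed_pos"
    using crossed_term_pos[OF continuous_on_diff[OF G(1) F(1)], of n] G(3)
    by (simp add: crossed_term_diff[OF G(1) F(1)])
  then show ?thesis
    using norm_q_le[OF crossed_term_pos[OF F] crossed_term_proper[OF G(1,2)]]
    by (simp add: susp_hom_term[OF G(1,2)])
qed

text \<open>Discarding the coefficients of degree other than \<open>n\<close> does not increase the norm of a majorant.\<close>

lemma norm_q_term_ge:
  assumes F: "continuous_on UNIV F" "\<And>x. 0 \<le> F x"
    and le: "\<And>G. continuous_on UNIV G \<Longrightarrow> depends_on_first n G \<Longrightarrow> (\<And>x. F x \<le> G x) \<Longrightarrow>
      c \<le> norm (\<iota> (\<lambda>x. G (itin x)) * E ^ n)"
  shows "c \<le> norm (q (crossed_term F n))"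
proof (rule norm_q_ge[OF crossed_term_pos[OF F]])
  \<comment> \<open>A constant is a proper majorant in every degree, so the infimum ranges over a
    nonempty set.\<close>
  obtain M where M: "\<And>x. \<bar>F x\<bar> \<le> M"
    using compact_UNIV_bounded[OF compact_UNIV_fun[OF compact_X] F(1)] by metis
  have "crossed_term (\<lambda>x. M) n - crossed_term F n \<in> crossed_pos"
    using crossed_term_pos[OF continuous_on_diff[OF continuous_on_const F(1)], of M n] M
    by (simp add: crossed_term_diff[OF continuous_on_const F(1)] abs_le_iff)
  moreover have "crossed_term (\<lambda>x. M) n \<in> proper"
    by (rule crossed_term_proper[OF continuous_on_const depends_on_first_const])
  ultimately show "\<exists>A'. A' \<in> proper \<and> A' - crossed_term F n \<in> crossed_pos" by blast
next
  fix A assume A: "A \<in> proper" "A - crossed_term F n \<in> crossed_pos"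
  let ?G = "coeff A n"
  have coeffs: "(if i = n then F x else 0) \<le> coeff A i x" for i x
    using A(2) by (simp add: crossed_pos_def coeff_minus coeff_crossed_term[OF F(1)])
  have G: "continuous_on UNIV ?G" "depends_on_first n ?G"
    using A(1) by (simp_all add: continuous_coeff proper_def)
  have FG: "F x \<le> ?G x" for x using coeffs[where i = n] by simp
  have B: "crossed_term ?G n \<in> proper" by (rule crossed_term_proper[OF G])
  have "c \<le> norm (\<pi> (crossed_term ?G n))"
    using le[OF G FG] by (simp add: susp_hom_term[OF G])
  also have "\<dots> \<le> norm (\<pi> A)"
  proof (rule norm_mono)
    have "0 \<le> ?G x" for x using F(2)[of x] FG[of x] by linarith
    then show "\<pi> (crossed_term ?G n) \<in> P"
      by (intro susp_hom_pos[OF is_susp_hom B] crossed_term_pos G)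
    have "0 \<le> coeff A i x" if "i \<noteq> n" for i x
      using coeffs[of i x] that by simp
    then have "A - crossed_term ?G n \<in> crossed_pos"
      by (auto simp: crossed_pos_def coeff_minus coeff_crossed_term[OF G(1)])
    then show "\<pi> A - \<pi> (crossed_term ?G n) \<in> P"
      using susp_hom_pos[OF is_susp_hom proper_diff[OF A(1) B]]
      by (simp add: susp_hom_diff[OF is_susp_hom A(1) B])
  qed
  finally show "c \<le> norm (\<pi> A)" .
qed

text \<open>A majorant of \<open>F\<close> restricts to a majorant along itineraries, where the norm
  is monotone. Vanishing in the suspension thus forces vanishing in the initial flow.\<close>

lemma norm_eval_le_norm_q_term:
  assumes F: "continuous_on UNIV F" "\<And>x. 0 \<le> F x"
  shows "norm (\<iota> (\<lambda>x. F (itin x)) * E ^ n) \<le> norm (q (crossed_term F n))"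
  by (rule norm_q_term_ge[OF F])
    (simp add: phase_ext_power_mono continuous_itinerary F)

text \<open>A proper operator has constant degree-zero coefficient.\<close>

lemma le_norm_q_degree_zero:
  assumes F: "continuous_on UNIV F" "\<And>x. 0 \<le> F x"
  shows "F y \<le> norm (q (crossed_term F 0))"
proof (rule norm_q_term_ge[OF F])
  fix G :: "(nat \<Rightarrow> 'x) \<Rightarrow> real" assume G: "depends_on_first 0 G" "\<And>x. F x \<le> G x"
  have "G x = G y" for x using G(1) by (simp add: depends_on_first_def)
  then have "(\<lambda>x. G (itin x)) = (\<lambda>x. G y)" by blast
  then show "F y \<le> norm (\<iota> (\<lambda>x. G (itin x)) * E ^ 0)"
    using F(2)[of y] G(2)[of y] by (simp add: phase_ext_const)
qed

section \<open>The phase algebra of the suspension\<close>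

text \<open>\<open>le_norm_q_degree_zero\<close> controls nonnegative functions, so it is applied to
  the square of the difference. Injectivity makes the description in \<open>susp_gelfand\<close>
  unique.\<close>

lemma q_degree_zero_inj:
  assumes F: "continuous_on UNIV F" and G: "continuous_on UNIV G"
    and eq: "q (crossed_term F 0) = q (crossed_term G 0)"
  shows "F = G"
proof
  fix y
  let ?H = "\<lambda>x. F x - G x"
  have H: "continuous_on UNIV ?H" by (rule continuous_on_diff[OF F G])
  have "q (crossed_term ?H 0) = 0"
    using eq by (simp add: crossed_term_diff[OF F G] linear_diff[OF q_linear])
  then have "q (crossed_term (\<lambda>x. ?H x * ?H x) 0) = 0"
    using q_mult[of "crossed_term ?H 0" "crossed_term ?H 0"] by (simp add: crossed_term_mult[OF H H])
  then have "?H y * ?H y \<le> 0"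
    using le_norm_q_degree_zero[OF continuous_on_mult[OF H H], of y] by simp
  then show "F y = G y" by (auto simp: mult_le_0_iff)
qed

lemma susp_gelfand_term:
  assumes "continuous_on UNIV F"
  shows "susp_gelfand q (q (crossed_term F 0)) = F"
  unfolding susp_gelfand_def
  by (rule the_equality) (use assms q_degree_zero_inj in blast)+

text \<open>The shift argument a third time; the bound \<open>2 * t\<close> comes from a constant
  proper majorant of \<open>F + t\<close>.\<close>

lemma bounded_inclusion_susp: "bounded_inclusion (susp_phase q) (susp_gelfand q) 3"
proof
  show "subspace (susp_phase q)"
  proof (rule subspaceI)
    have "crossed_term (\<lambda>x. 0) 0 = (0 :: 'x crossed)"
      by (rule crossed_eqI) (simp add: coeff_crossed_term coeff_zero)
    then show "0 \<in> susp_phase q"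
      unfolding susp_phase_def using linear_0[OF q_linear]
      by (auto intro!: exI[of _ "\<lambda>x. 0"])
  next
    fix a b assume "a \<in> susp_phase q" "b \<in> susp_phase q"
    then obtain F G where "continuous_on UNIV F" "continuous_on UNIV G"
        "a = q (crossed_term F 0)" "b = q (crossed_term G 0)"
      unfolding susp_phase_def by blast
    then show "a + b \<in> susp_phase q"
      unfolding susp_phase_def
      by (auto simp: linear_add[OF q_linear] crossed_term_add intro!: exI[of _ "\<lambda>x. F x + G x"]
          continuous_on_add)
  next
    fix t a assume "a \<in> susp_phase q"
    then obtain F where "continuous_on UNIV F" "a = q (crossed_term F 0)"
      unfolding susp_phase_def by blast
    then show "t *\<^sub>R a \<in> susp_phase q"
      unfolding susp_phase_def
      by (auto simp: linear_scale[OF q_linear] crossed_term_scale intro!: exI[of _ "\<lambda>x. t * F x"]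
          continuous_on_mult_left)
  qed
next
  fix a b x assume "a \<in> susp_phase q" "b \<in> susp_phase q"
  then obtain F G where FG: "continuous_on UNIV F" "continuous_on UNIV G"
      "a = q (crossed_term F 0)" "b = q (crossed_term G 0)"
    unfolding susp_phase_def by blast
  then have "a - b = q (crossed_term (\<lambda>x. F x - G x) 0)"
    by (simp add: linear_diff[OF q_linear] crossed_term_diff)
  then show "susp_gelfand q (a - b) x = susp_gelfand q a x - susp_gelfand q b x"
    by (simp add: FG susp_gelfand_term continuous_on_diff)
next
  fix a t assume a: "a \<in> susp_phase q" and bound: "\<And>x. \<bar>susp_gelfand q a x\<bar> \<le> t"
  obtain F where F: "continuous_on UNIV F" "a = q (crossed_term F 0)"
    using a unfolding susp_phase_def by blast
  have pm: "- t \<le> F x" "F x \<le> t" for x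
    using bound[of x] by (simp_all add: F susp_gelfand_term abs_le_iff)
  have "0 \<le> t" using pm[of undefined] by linarith
  have "crossed_term (\<lambda>x. t) 0 = t *\<^sub>R (1 :: 'x crossed)"
    using crossed_term_scale[of "\<lambda>x. 1" t 0] by (simp add: one_crossed_def)
  then have qt: "q (crossed_term (\<lambda>x. t) 0) = t *\<^sub>R 1"
    by (simp add: linear_scale[OF q_linear] q_one)
  have "norm (q (crossed_term (\<lambda>x. F x + t) 0)) \<le> norm (\<iota> (\<lambda>x. 2 * t) * E ^ 0)"
  proof (rule norm_q_term_le)
    show "continuous_on UNIV (\<lambda>x. F x + t)" by (intro continuous_on_add F continuous_on_const)
    show "0 \<le> F x + t" "F x + t \<le> 2 * t" for x using pm[of x] by linarith+
  qed (simp_all add: depends_on_first_const)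
  then have "norm (a + t *\<^sub>R 1) \<le> 2 * t"
    using \<open>0 \<le> t\<close>
    by (simp add: phase_ext_const crossed_term_add[OF F(1) continuous_on_const]
        linear_add[OF q_linear] qt F(2))
  then show "norm a \<le> 3 * t"
    using norm_triangle_ineq4[of "a + t *\<^sub>R 1" "t *\<^sub>R 1"] \<open>0 \<le> t\<close> by simp
qed simp

text \<open>Every continuous function already belongs to the phase algebra of the suspension, so a
  constant sequence computes the extension.\<close>

lemma phase_ext_susp:
  assumes F: "continuous_on UNIV F"
  shows "phase_ext (susp_phase q) (susp_gelfand q) F = q (crossed_term F 0)"
  using bounded_inclusion.phase_ext_theta[OF bounded_inclusion_susp, of "q (crossed_term F 0)"] F
  by (auto simp: susp_gelfand_term susp_phase_def)

lemma phase_ext_susp_power: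
  assumes F: "continuous_on UNIV F"
  shows "phase_ext (susp_phase q) (susp_gelfand q) F * susp_E q ^ n = q (crossed_term F n)"
proof -
  have "crossed_term F 0 * crossed_term (\<lambda>x. 1) 1 ^ n = crossed_term F n"
    unfolding crossed_term_power[OF continuous_on_const]
    by (simp add: crossed_term_mult[OF F])
  then show ?thesis
    unfolding phase_ext_susp[OF F] susp_E_def by (simp flip: q_power q_mult)
qed

end

section \<open>Supports\<close>

context suspended_flow
begin

lemma unessential_susp_iff:
  "unessential (susp_phase q) (susp_gelfand q) (susp_E q) F \<longleftrightarrow>
    continuous_on UNIV F \<and> (\<exists>n. q (crossed_term F n) = 0)"
  unfolding unessential_def using phase_ext_susp_power by auto

text \<open>The norm estimates for monomials require nonnegative coefficients; squaring provides
  them while \<open>q\<close> still annihilates the term in the same degree.\<close>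

lemma q_square_term:
  assumes F: "continuous_on UNIV F" and zero: "q (crossed_term F n) = 0"
  shows "q (crossed_term (\<lambda>x. F x * F x) n) = 0"
  using zero q_mult[of "crossed_term F 0" "crossed_term F n"] by (simp add: crossed_term_mult[OF F F])

lemma itinerary_in_susp_support:
  assumes x: "x \<in> flow_support C \<theta> E"
  shows "itin x \<in> flow_support (susp_phase q) (susp_gelfand q) (susp_E q)"
  unfolding flow_support_def unessential_susp_iff
proof (intro CollectI allI impI)
  fix F assume "continuous_on UNIV F \<and> (\<exists>n. q (crossed_term F n) = 0)"
  then obtain n where F: "continuous_on UNIV F" "q (crossed_term F n) = 0" by blast
  let ?S = "\<lambda>x. F x * F x"
  have S: "continuous_on UNIV ?S" by (rule continuous_on_mult[OF F(1) F(1)])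
  have "norm (\<iota> (\<lambda>x. ?S (itin x)) * E ^ n) \<le> 0"
    using norm_eval_le_norm_q_term[OF S, of n] q_square_term[OF F] by simp
  then have "unessential C \<theta> E (\<lambda>x. ?S (itin x))"
    unfolding unessential_def using continuous_itinerary[OF S] by auto
  with x have "?S (itin x) = 0" unfolding flow_support_def by blast
  then show "F (itin x) = 0" by simp
qed

text \<open>A nonnegative function of \<open>n\<close> coordinates is its own proper majorant in
  degree \<open>n\<close>, so it is unessential for the suspension as soon as its evaluation in that
  degree vanishes.\<close>

lemma susp_unessential:
  assumes G: "continuous_on UNIV G" "depends_on_first n G" "\<And>x. 0 \<le> G x"
    and zero: "\<iota> (\<lambda>x. G (itin x)) * E ^ n = 0"
    and y: "y \<in> flow_support (susp_phase q) (susp_gelfand q) (susp_E q)"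
  shows "G y = 0"
proof -
  have "q (crossed_term G n) = 0"
    using norm_q_term_le[OF G(1,3) G(1,2)] zero by simp
  then show ?thesis
    using y G(1) unfolding flow_support_def unessential_susp_iff by blast
qed

lemma susp_support_in_support:
  assumes y: "y \<in> flow_support (susp_phase q) (susp_gelfand q) (susp_E q)"
  shows "y 0 \<in> flow_support C \<theta> E"
  unfolding flow_support_def unessential_def
proof (intro CollectI allI impI)
  fix f :: "'x \<Rightarrow> real" assume "continuous_on UNIV f \<and> (\<exists>n. \<iota> f * E ^ n = 0)"
  then obtain n where f: "continuous_on UNIV f" and zero: "\<iota> f * E ^ n = 0" by blast
  let ?G = "\<lambda>y::nat \<Rightarrow> 'x. f (y 0) * f (y 0)"
  \<comment> \<open>Reading coordinate 0 needs degree at least 1, while \<open>n\<close> may be 0;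
    one more factor \<open>E\<close> keeps the product zero.\<close>
  have "?G y = 0"
  proof (rule susp_unessential[where n = "Suc n", OF _ _ _ _ y])
    show "continuous_on UNIV ?G"
      by (intro continuous_on_mult continuous_on_coordinate f)
    show "depends_on_first (Suc n) ?G" by (simp add: depends_on_first_def)
    have "\<iota> (\<lambda>x. ?G (itin x)) * E ^ Suc n = \<iota> f * (\<iota> f * E ^ n) * E"
      by (simp only: itinerary_def funpow_0 phase_ext_mult[OF f f] power_Suc2 mult.assoc)
    then show "\<iota> (\<lambda>x. ?G (itin x)) * E ^ Suc n = 0" using zero by simp
  qed simp
  then show "f (y 0) = 0" by simp
qed

lemma susp_support_is_itinerary:
  assumes y: "y \<in> flow_support (susp_phase q) (susp_gelfand q) (susp_E q)"
  shows "y = itin (y 0)"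
proof
  fix k
  show "y k = itin (y 0) k"
  proof (rule ccontr)
    assume "y k \<noteq> itin (y 0) k"
    then obtain f :: "'x \<Rightarrow> real" where f: "continuous_on UNIV f" "f (y k) \<noteq> f (itin (y 0) k)"
      using urysohn_separates[OF compact_X] by metis
    let ?g = "\<lambda>x. f ((\<alpha> ^^ k) x)"
    have g: "continuous_on UNIV ?g" by (rule continuous_on_compose_funpow[OF f(1)])
    \<comment> \<open>\<open>?D\<close> vanishes on every itinerary, so its evaluation is zero in
      all degrees. It reads coordinates 0 and \<open>k\<close>, hence the degree
      \<open>Suc k\<close>.\<close>
    let ?D = "\<lambda>y::nat \<Rightarrow> 'x. f (y k) - ?g (y 0)"
    have "?D y * ?D y = 0"
    proof (rule susp_unessential[where n = "Suc k", OF _ _ _ _ y])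
      show "continuous_on UNIV (\<lambda>y. ?D y * ?D y)"
        by (intro continuous_on_mult continuous_on_diff continuous_on_coordinate f(1) g)
      show "depends_on_first (Suc k) (\<lambda>y. ?D y * ?D y)" by (simp add: depends_on_first_def)
      show "\<iota> (\<lambda>x. ?D (itin x) * ?D (itin x)) * E ^ Suc k = 0"
        by (simp add: itinerary_def phase_ext_const)
    qed simp
    then show False using f(2) by (simp add: itinerary_def)
  qed
qed

lemma bij_betw_supports:
  "bij_betw itin (flow_support C \<theta> E) (flow_support (susp_phase q) (susp_gelfand q) (susp_E q))"
  unfolding bij_betw_def
proof
  show "inj_on itin (flow_support C \<theta> E)"
    by (rule inj_on_inverseI[where g = "\<lambda>y. y 0"]) (simp add: itinerary_def)
  show "itin ` flow_support C \<theta> E = flow_support (susp_phase q) (susp_gelfand q) (susp_E q)"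
  proof (rule set_eqI, rule iffI)
    fix y assume "y \<in> itin ` flow_support C \<theta> E"
    then show "y \<in> flow_support (susp_phase q) (susp_gelfand q) (susp_E q)"
      by (rule imageE) (simp only: itinerary_in_susp_support)
  next
    fix y assume y: "y \<in> flow_support (susp_phase q) (susp_gelfand q) (susp_E q)"
    have "itin (y 0) \<in> itin ` flow_support C \<theta> E"
      by (rule imageI[OF susp_support_in_support[OF y]])
    then show "y \<in> itin ` flow_support C \<theta> E"
      by (simp only: susp_support_is_itinerary[OF y, symmetric])
  qed
qed

end

section \<open>Spectral potentials\<close>

text \<open>
  The two sequences have the same set of limits in the extended reals; whether they converge at all
  is irrelevant here.
\<close>

lemma lim_ln_ext_eq:
  fixes a b :: "nat \<Rightarrow> real"
  assumes nonneg: "\<And>n. 0 \<le> a n" and le: "\<And>n. a n \<le> b n"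
    and ge: "\<And>\<epsilon>. 0 < \<epsilon> \<Longrightarrow> \<exists>c m. \<forall>n\<ge>m. b n \<le> exp (real n * \<epsilon> + c) * a n"
  shows "lim (\<lambda>n. ln_ext (b n) / ereal (real n)) = lim (\<lambda>n. ln_ext (a n) / ereal (real n))"
proof -
  \<comment> \<open>The default 0 fits because \<open>b n\<close> vanishes together with
    \<open>a n\<close> for large \<open>n\<close>, so the two quotients coincide there.\<close>
  define d where "d n = (if a n = 0 then 0 else (ln (b n) - ln (a n)) / real n)" for n
  have pos: "0 < a n" "0 < b n" if "a n \<noteq> 0" for n
    using that nonneg[of n] le[of n] by linarith+
  have "d \<longlonglongrightarrow> 0"
  proof (rule LIMSEQ_I)
    fix r :: real assume "0 < r"
    \<comment> \<open>Half of \<open>r\<close> bounds the growth rate; the other half absorbs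
      \<open>c\<close> once \<open>n\<close> exceeds \<open>k\<close>.\<close>
    then obtain c m where cm: "\<And>n. n \<ge> m \<Longrightarrow> b n \<le> exp (real n * (r / 2) + c) * a n"
      using ge[of "r / 2"] by auto
    obtain k :: nat where k: "2 * \<bar>c\<bar> / r < real k" using reals_Archimedean2 by blast
    have "\<bar>d n\<bar> < r" if n: "n \<ge> Suc (max m k)" for n
    proof (cases "a n = 0")
      case False
      note p = pos[OF False]
      have "0 < n" using n by simp
      have "ln (b n) \<le> ln (exp (real n * (r / 2) + c) * a n)"
        using p cm[of n] n by (subst ln_le_cancel_iff) auto
      also have "\<dots> = real n * (r / 2) + c + ln (a n)"
        using p by (simp add: ln_mult)
      finally have "(ln (b n) - ln (a n)) \<le> real n * (r / 2) + \<bar>c\<bar>" by linarith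
      also have "\<bar>c\<bar> < real n * (r / 2)"
      proof -
        have "2 * \<bar>c\<bar> / r < real n" using k n by linarith
        then show ?thesis using \<open>0 < r\<close> by (simp add: field_simps)
      qed
      finally have "ln (b n) - ln (a n) < r * real n" by simp
      moreover have "0 \<le> ln (b n) - ln (a n)" using p le[of n] by simp
      ultimately show ?thesis
        using False \<open>0 < n\<close> by (simp add: d_def field_simps)
    qed (simp add: d_def \<open>0 < r\<close>)
    then show "\<exists>N. \<forall>n\<ge>N. norm (d n - 0) < r" by auto
  qed
  then have d: "(\<lambda>n. ereal (d n)) \<longlonglongrightarrow> ereal 0" "(\<lambda>n. ereal (- d n)) \<longlonglongrightarrow> ereal 0"
    using tendsto_minus[of d 0] by (auto simp del: uminus_ereal.simps)
  \<comment> \<open>A single finite factor suffices to see that \<open>a n = 0\<close> forces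
    \<open>b n = 0\<close> from \<open>m\<close> on.\<close>
  obtain c m where cm: "\<And>n. n \<ge> m \<Longrightarrow> b n \<le> exp (real n * 1 + c) * a n"
    using ge[of 1] by auto
  let ?u = "\<lambda>n. ln_ext (a n) / ereal (real n)" and ?v = "\<lambda>n. ln_ext (b n) / ereal (real n)"
  \<comment> \<open>Starting at \<open>Suc m\<close> also excludes \<open>n = 0\<close>, where the
    quotients would divide by zero.\<close>
  have uv: "?v n = ?u n + ereal (d n)" "?u n = ?v n + ereal (- d n)" if n: "n \<ge> Suc m" for n
  proof -
    show "?v n = ?u n + ereal (d n)"
    proof (cases "a n = 0")
      case True
      then have "b n = 0" using cm[of n] n le[of n] by simp
      with True show ?thesis by (simp add: d_def)
    next
      case False
      then show ?thesis
        using pos[OF False] n by (simp add: ln_ext_def d_def field_simps)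
    qed
    then show "?u n = ?v n + ereal (- d n)"
      by (cases "?u n") simp_all
  qed
  \<comment> \<open>The corrections tend to the finite value 0, so they preserve extended limits,
    infinite ones included.\<close>
  have "?v \<longlonglongrightarrow> L \<longleftrightarrow> ?u \<longlonglongrightarrow> L" for L
  proof
    assume "?v \<longlonglongrightarrow> L"
    from tendsto_add_ereal_general1[OF _ this d(2)]
    have "(\<lambda>n. ?v n + ereal (- d n)) \<longlonglongrightarrow> L" by simp
    then show "?u \<longlonglongrightarrow> L"
      by (rule Lim_transform_eventually) (rule eventually_sequentiallyI[OF uv(2)[symmetric]])
  next
    assume "?u \<longlonglongrightarrow> L"
    from tendsto_add_ereal_general1[OF _ this d(1)]
    have "(\<lambda>n. ?u n + ereal (d n)) \<longlonglongrightarrow> L" by simp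
    then show "?v \<longlonglongrightarrow> L"
      by (rule Lim_transform_eventually) (rule eventually_sequentiallyI[OF uv(1)[symmetric]])
  qed
  then show ?thesis unfolding lim_def by simp
qed

section \<open>Birkhoff sums and the comparison of growth rates\<close>

definition birkhoff :: "((nat \<Rightarrow> 'x) \<Rightarrow> real) \<Rightarrow> nat \<Rightarrow> (nat \<Rightarrow> 'x) \<Rightarrow> real" where
  "birkhoff \<phi> n x = (\<Sum>k<n. \<phi> ((shift ^^ k) x))"

lemma continuous_birkhoff:
  fixes \<phi> :: "(nat \<Rightarrow> 'x::topological_space) \<Rightarrow> real"
  assumes "continuous_on UNIV \<phi>"
  shows "continuous_on UNIV (birkhoff \<phi> n)"
  unfolding birkhoff_def
  by (intro continuous_on_sum)
    (use continuous_on_compose2[OF assms continuous_on_shift_funpow] in simp)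

lemma depends_on_first_birkhoff:
  fixes \<phi> :: "(nat \<Rightarrow> 'x) \<Rightarrow> real"
  assumes "depends_on_first m \<phi>" "n + m \<le> N"
  shows "depends_on_first N (birkhoff \<phi> n)"
  unfolding depends_on_first_def birkhoff_def
proof (intro allI impI sum.cong refl)
  fix x y :: "nat \<Rightarrow> 'x" and k
  assume "\<forall>j<N. x j = y j" "k \<in> {..<n}"
  then have "\<forall>j<m. (shift ^^ k) x j = (shift ^^ k) y j"
    using assms(2) by (simp add: shift_funpow)
  then show "\<phi> ((shift ^^ k) x) = \<phi> ((shift ^^ k) y)"
    using assms(1) unfolding depends_on_first_def by blast
qed

context suspended_flow
begin

text \<open>Both powers are images of one power of \<open>exp \<phi> E\<close> in the crossed
  algebra, the first under \<open>eval_crossed\<close> and the second under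
  \<open>q\<close>.\<close>

lemma weighted_E_power:
  assumes \<phi>: "continuous_on UNIV \<phi>"
  defines "H \<equiv> \<lambda>n x. exp (birkhoff \<phi> n x)"
  shows "(\<iota> (\<lambda>x. exp (\<phi> (itin x))) * E) ^ n = \<iota> (\<lambda>x. H n (itin x)) * E ^ n"
    and "(phase_ext (susp_phase q) (susp_gelfand q) (\<lambda>x. exp (\<phi> x)) * susp_E q) ^ n =
      q (crossed_term (H n) n)"
proof -
  let ?T = "crossed_term (\<lambda>x. exp (\<phi> x)) 1"
  have e: "continuous_on UNIV (\<lambda>x. exp (\<phi> x))" by (intro continuous_on_exp \<phi>)
  have H: "continuous_on UNIV (H n)"
    unfolding H_def by (intro continuous_on_exp continuous_birkhoff \<phi>)
  have T: "?T ^ n = crossed_term (H n) n"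
    unfolding crossed_term_power[OF e] by (simp add: H_def birkhoff_def exp_sum)
  have "eval_crossed (A ^ n) = eval_crossed A ^ n" for A
  proof (induction n)
    case 0
    then show ?case
      using is_susp_hom_eval_crossed by (simp add: is_susp_hom_def)
  qed (simp add: eval_crossed_mult)
  then have "eval_crossed ?T ^ n = eval_crossed (crossed_term (H n) n)"
    by (simp only: T[symmetric])
  then show "(\<iota> (\<lambda>x. exp (\<phi> (itin x))) * E) ^ n = \<iota> (\<lambda>x. H n (itin x)) * E ^ n"
    unfolding eval_crossed_term[OF e] eval_crossed_term[OF H] by simp
  show "(phase_ext (susp_phase q) (susp_gelfand q) (\<lambda>x. exp (\<phi> x)) * susp_E q) ^ n =
      q (crossed_term (H n) n)"
    using phase_ext_susp_power[OF e, of 1] T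
    by (simp flip: q_power)
qed

text \<open>
  The exponent \<open>birkhoff \<phi> n\<close> depends on infinitely many coordinates. Replacing \<open>\<phi>\<close> by a
  function \<open>\<psi>\<close> of \<open>m\<close> coordinates and dropping the last \<open>m\<close> summands yields an exponent that
  depends on \<open>n\<close> coordinates only and differs from it by at most \<open>2 n \<delta> + 2 m M\<close>.
\<close>

lemma norm_q_term_birkhoff_le:
  assumes \<phi>: "continuous_on UNIV \<phi>" and "0 < \<epsilon>"
  shows "\<exists>c m. \<forall>n\<ge>m. norm (q (crossed_term (\<lambda>x. exp (birkhoff \<phi> n x)) n)) \<le>
    exp (real n * \<epsilon> + c) * norm (\<iota> (\<lambda>x. exp (birkhoff \<phi> n (itin x))) * E ^ n)"
proof -
  define \<delta> where "\<delta> = \<epsilon> / 2"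
  have "0 < \<delta>" using \<open>0 < \<epsilon>\<close> by (simp add: \<delta>_def)
  obtain \<psi> m where \<psi>: "continuous_on UNIV \<psi>" "depends_on_first m \<psi>" "\<And>x. \<bar>\<phi> x - \<psi> x\<bar> < \<delta>"
    using cylinder_dense[OF compact_X \<phi> \<open>0 < \<delta>\<close>] by metis
  obtain M where M: "\<And>x. \<bar>\<phi> x\<bar> \<le> M"
    using compact_UNIV_bounded[OF compact_UNIV_fun[OF compact_X] \<phi>] by metis
  \<comment> \<open>Twice the error from the dropped summands: the majorant raises the exponent by
    the error once, and the truncation may already lie above by as much.\<close>
  define c where "c = 2 * (real m * M)"
  have "norm (q (crossed_term (\<lambda>x. exp (birkhoff \<phi> n x)) n)) \<le>
    exp (real n * \<epsilon> + c) * norm (\<iota> (\<lambda>x. exp (birkhoff \<phi> n (itin x))) * E ^ n)"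
    if "n \<ge> m" for n
  proof -
    let ?S = "birkhoff \<phi> n"
    \<comment> \<open>Raising the truncated sum by the maximal error turns it into a majorant of
      \<open>?S\<close> that still reads only \<open>n\<close> coordinates, since
      \<open>(n - m) + m = n\<close>.\<close>
    let ?R = "\<lambda>x. birkhoff \<psi> (n - m) x + (real n * \<delta> + real m * M)"
    have close: "\<bar>?S x - birkhoff \<psi> (n - m) x\<bar> \<le> real n * \<delta> + real m * M" for x
    proof -
      have split: "?S x = birkhoff \<phi> (n - m) x + (\<Sum>k=n-m..<n. \<phi> ((shift ^^ k) x))"
        unfolding birkhoff_def atLeast0LessThan[symmetric]
        by (rule sum.atLeastLessThan_concat[symmetric]) simp_all
      have "\<bar>birkhoff \<phi> (n - m) x - birkhoff \<psi> (n - m) x\<bar> \<le> (\<Sum>k<n-m. \<delta>)"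
        unfolding birkhoff_def sum_subtractf[symmetric]
        by (rule order_trans[OF sum_abs sum_mono]) (use \<psi>(3) less_imp_le in blast)
      also have "\<dots> \<le> real n * \<delta>" using \<open>0 < \<delta>\<close> by simp
      finally have "\<bar>birkhoff \<phi> (n - m) x - birkhoff \<psi> (n - m) x\<bar> \<le> real n * \<delta>" .
      moreover have "\<bar>\<Sum>k=n-m..<n. \<phi> ((shift ^^ k) x)\<bar> \<le> (\<Sum>k=n-m..<n. M)"
        by (rule order_trans[OF sum_abs sum_mono]) (rule M)
      then have "\<bar>\<Sum>k=n-m..<n. \<phi> ((shift ^^ k) x)\<bar> \<le> real m * M"
        using that by simp
      ultimately show ?thesis unfolding split by linarith
    qed
    have S: "continuous_on UNIV (\<lambda>x. exp (?S x))"
      by (intro continuous_on_exp continuous_birkhoff \<phi>)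
    have R: "continuous_on UNIV (\<lambda>x. exp (?R x))"
      by (intro continuous_on_exp continuous_on_add continuous_birkhoff \<psi>(1) continuous_on_const)
    have R_dep: "depends_on_first n (\<lambda>x. exp (?R x))"
      using depends_on_first_birkhoff[OF \<psi>(2), of "n - m" n] that
      by (simp add: depends_on_first_def)
    have "real n * \<epsilon> = 2 * (real n * \<delta>)" by (simp add: \<delta>_def)
    then have SR: "?S x \<le> ?R x" and RS: "?R x \<le> ?S x + (real n * \<epsilon> + c)" for x
      using close[of x] unfolding c_def by linarith+
    have "norm (q (crossed_term (\<lambda>x. exp (?S x)) n)) \<le> norm (\<iota> (\<lambda>x. exp (?R (itin x))) * E ^ n)"
      by (rule norm_q_term_le[OF S _ R R_dep]) (simp_all add: SR)
    also have "\<dots> \<le> norm (\<iota> (\<lambda>x. exp (real n * \<epsilon> + c) * exp (?S (itin x))) * E ^ n)"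
    proof (rule phase_ext_power_mono)
      show "continuous_on UNIV (\<lambda>x. exp (?R (itin x)))" by (rule continuous_itinerary[OF R])
      show "continuous_on UNIV (\<lambda>x. exp (real n * \<epsilon> + c) * exp (?S (itin x)))"
        by (intro continuous_on_mult_left continuous_itinerary[OF S])
      show "exp (?R (itin x)) \<le> exp (real n * \<epsilon> + c) * exp (?S (itin x))" for x
        using RS[of "itin x"] by (simp add: add.commute flip: exp_add)
    qed simp
    also have "\<dots> = exp (real n * \<epsilon> + c) * norm (\<iota> (\<lambda>x. exp (?S (itin x))) * E ^ n)"
      by (simp add: phase_ext_scale[OF continuous_itinerary[OF S]])
    finally show ?thesis .
  qed
  then show ?thesis by blast
qed

text \<open>The norms behind the two potentials agree up to a factor
  \<open>exp (n * \<epsilon> + c)\<close> for large \<open>n\<close>, with \<open>\<epsilon>\<close>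
  arbitrary, and this factor disappears in the limit by \<open>lim_ln_ext_eq\<close>.\<close>

lemma spectral_potential_susp:
  assumes \<phi>: "continuous_on UNIV \<phi>"
  shows "spectral_potential (susp_phase q) (susp_gelfand q) (susp_E q) \<phi> =
    spectral_potential C \<theta> E (\<phi> \<circ> itin)"
  unfolding spectral_potential_def comp_def weighted_E_power[OF \<phi>]
proof (rule lim_ln_ext_eq)
  show "norm (\<iota> (\<lambda>x. exp (birkhoff \<phi> n (itin x))) * E ^ n) \<le>
      norm (q (crossed_term (\<lambda>x. exp (birkhoff \<phi> n x)) n))" for n
    by (rule norm_eval_le_norm_q_term) (simp_all add: continuous_on_exp continuous_birkhoff \<phi>)
  show "\<exists>c m. \<forall>n\<ge>m. norm (q (crossed_term (\<lambda>x. exp (birkhoff \<phi> n x)) n)) \<le>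
      exp (real n * \<epsilon> + c) * norm (\<iota> (\<lambda>x. exp (birkhoff \<phi> n (itin x))) * E ^ n)" if "0 < \<epsilon>" for \<epsilon>
    by (rule norm_q_term_birkhoff_le[OF \<phi> that])
qed simp

end

theorem proposition9p4:
  fixes P C :: "'a::{real_normed_algebra_1,banach} set"
    and \<theta> :: "'a \<Rightarrow> 'x::t2_space \<Rightarrow> real"
    and E :: 'a
    and \<alpha>s :: "'a \<Rightarrow> 'a"
    and q :: "'x crossed \<Rightarrow> 'b::{real_normed_algebra_1,banach}"
  assumes flow: "covariant_positive_flow P C \<theta> E \<alpha>s"
    and finite_potential:
      "\<And>\<phi>. continuous_on UNIV \<phi> \<Longrightarrow> \<bar>spectral_potential C \<theta> E \<phi>\<bar> \<noteq> \<infinity>"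
    and suspension: "suspension_completion P C \<theta> E q"
  shows "bij_betw (itinerary (flow_map C \<theta> \<alpha>s))
           (flow_support C \<theta> E)
           (flow_support (susp_phase q) (susp_gelfand q) (susp_E q)) \<and>
         (\<forall>\<phi>. continuous_on UNIV \<phi> \<longrightarrow>
           spectral_potential (susp_phase q) (susp_gelfand q) (susp_E q) \<phi> =
           spectral_potential C \<theta> E (\<phi> \<circ> itinerary (flow_map C \<theta> \<alpha>s)))"
proof -
  interpret suspended_flow P C \<theta> E \<alpha>s q
    by (intro suspended_flow.intro suspended_flow_axioms.intro flow suspension)
  show ?thesis
    by (intro conjI allI impI bij_betw_supports spectral_potential_susp)
qed

end
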